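(* Let $\varepsilon\in(0,1)$ and $\alpha,\beta\in[0,\infty]$. Let $\mathbf{D}_\beta$ be any quantum extension of the classical Rényi divergence $D_\beta$, let $\mathbf{D}_\beta^\varepsilon$ be its $\varepsilon$-smoothed version, and let $D_\alpha^{\mathbb M}$ be the measured (minimal) quantum extension of the classical Rényi divergence $D_\alpha$. Define $$\nu(\varepsilon,\alpha,\beta):=\sup_A\sup_{\rho,\sigma\in\mathfrak{D}(A)}\Big\{D_\alpha^{\mathbb M}(\rho\|\sigma)-\mathbf{D}_\beta^\varepsilon(\rho\|\sigma)\Big\},$$ where the supremum is over all finite-dimensional systems $A$; i.e. $\nu(\varepsilon,\alpha,\beta)$ is the smallest number such that $\mathbf{D}_\beta^\varepsilon(\rho\|\sigma)\ge D_\alpha^{\mathbb M}(\rho\|\sigma)-\nu(\varepsilon,\alpha,\beta)$ for all finite-dimensional $A$ and all $\rho,\sigma\in\mathfrak D(A)$ (and $\nu=\infty$ if there is no such finite number). Then $$\nu(\varepsilon,\alpha,\beta)=\begin{cases}\left(\frac1{\beta-1}+\frac1{1-\alpha}\right)\log\frac1{1-\varepsilon}&\text{if }\beta>1>\alpha,\\ \infty&\text{otherwise,}\end{cases}$$ where $\frac1{\beta-1}=0$ for $\beta=\infty$.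
   Context: $\log$ is base 2. $\mathrm{Prob}(d)$ is the set of $d$-dimensional probability vectors. Classical Rényi divergence: for $\alpha\in(0,1)\cup(1,\infty)$ and $\mathbf p,\mathbf q\in\mathrm{Prob}(d)$, $D_\alpha(\mathbf p\|\mathbf q)=\frac1{\alpha-1}\log\sum_x p_x^\alpha q_x^{1-\alpha}$, equal to $\infty$ if $\alpha>1$ and $\mathrm{supp}(\mathbf p)\not\subseteq\mathrm{supp}(\mathbf q)$, or if $\alpha<1$ and the supports are disjoint; by continuity $D_0(\mathbf p\|\mathbf q)=-\log\sum_{x:p_x>0}q_x$, $D_1$ is the Kullback–Leibler divergence, and $D_\infty(\mathbf p\|\mathbf q)=\log\max_{x:p_x>0}p_x/q_x$. $\mathfrak{D}(A)$ is the set of density operators on a finite-dimensional Hilbert space $A$. A quantum divergence is a function $\mathbf D$ on pairs of density operators (in all finite dimensions) with values in $\mathbb R\cup\{\infty\}$ such that $\mathbf D(\mathcal E(\rho)\|\mathcal E(\sigma))\le\mathbf D(\rho\|\sigma)$ for every completely positive trace-preserving map $\mathcal E$. A quantum extension of a classical divergence $D$ is a quantum divergence that coincides with $D$ on commuting (simultaneously diagonal) states. The measured extension is $D_\alpha^{\mathbb M}(\rho\|\sigma)=\sup_{\mathcal E}D_\alpha(\mathcal E(\rho)\|\mathcal E(\sigma))$, the supremum running over all POVM measurement channels $\mathcal E$ from $A$ to a finite classical system $X$. Quantum smoothing: $\mathfrak B^\varepsilon(\rho)=\{\rho'\in\mathfrak D(A):\frac12\|\rho-\rho'\|_1\le\varepsilon\}$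 and $\mathbf D_\beta^\varepsilon(\rho\|\sigma)=\inf_{\rho'\in\mathfrak B^\varepsilon(\rho)}\mathbf D_\beta(\rho'\|\sigma)$. *)

theory Defs
  imports
    "Jordan_Normal_Form.Schur_Decomposition"
    "HOL-Library.Extended_Real"
begin

section \<open>Classical Renyi divergence\<close>

definition prob_vecs :: "nat \<Rightarrow> real vec set" where
  "prob_vecs d = {p \<in> carrier_vec d. (\<forall>x<d. 0 \<le> p $ x) \<and> (\<Sum>x<d. p $ x) = 1}"

definition vec_supp :: "real vec \<Rightarrow> nat set" where
  "vec_supp p = {x. x < dim_vec p \<and> 0 < p $ x}"

text \<open>
  The sums run over the support of \<open>p\<close>; this only drops terms that are \<open>0\<close> under the
  conventions \<open>0 powr a = 0\<close> and \<open>0 * log 0 = 0\<close>.  At order \<open>0\<close> disjoint supports give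
  \<open>- log 0 = \<infinity>\<close>, which is spelled out because \<open>log 2 0 = 0\<close> in the library.
\<close>

definition renyi_div :: "ereal \<Rightarrow> real vec \<Rightarrow> real vec \<Rightarrow> ereal" where
  "renyi_div \<alpha> p q =
     (if \<alpha> < 1 \<and> vec_supp p \<inter> vec_supp q = {} then \<infinity>
      else if 1 \<le> \<alpha> \<and> \<not> vec_supp p \<subseteq> vec_supp q then \<infinity>
      else if \<alpha> = 0 then ereal (- log 2 (\<Sum>x\<in>vec_supp p. q $ x))
      else if \<alpha> = 1 then ereal (\<Sum>x\<in>vec_supp p. p $ x * log 2 (p $ x / q $ x))
      else if \<alpha> = \<infinity> then ereal (log 2 (Max ((\<lambda>x. p $ x / q $ x) ` vec_supp p)))
      else let a = real_of_ereal \<alpha> in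
        ereal (1 / (a - 1) * log 2 (\<Sum>x\<in>vec_supp p. (p $ x) powr a * (q $ x) powr (1 - a))))"


section \<open>Density operators and channels\<close>

text \<open>
  A system \<open>A\<close> is \<open>\<complex>\<^sup>n\<close>, and operators on it are matrices in \<open>carrier_mat n n\<close>.  In \<open>psd\<close>,
  \<open>0 \<le> z\<close> for complex \<open>z\<close> means that \<open>z\<close> is real and nonnegative, so that
  \<open>psd\<close> matrices are Hermitian.
\<close>

definition psd :: "nat \<Rightarrow> complex mat \<Rightarrow> bool" where
  "psd n A \<longleftrightarrow> A \<in> carrier_mat n n \<and> (\<forall>v\<in>carrier_vec n. 0 \<le> (A *\<^sub>v v) \<bullet>c v)"

definition mat_trace :: "complex mat \<Rightarrow> complex" where
  "mat_trace A = (\<Sum>i<dim_row A. A $$ (i, i))"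

definition density_ops :: "nat \<Rightarrow> complex mat set" where
  "density_ops n = {\<rho>. psd n \<rho> \<and> mat_trace \<rho> = 1}"

definition psd_sqrt :: "nat \<Rightarrow> complex mat \<Rightarrow> complex mat" where
  "psd_sqrt n A = (THE S. psd n S \<and> S * S = A)"

definition trace_norm :: "complex mat \<Rightarrow> real" where
  "trace_norm X = Re (mat_trace (psd_sqrt (dim_col X) (mat_adjoint X * X)))"

definition linear_map :: "nat \<Rightarrow> nat \<Rightarrow> (complex mat \<Rightarrow> complex mat) \<Rightarrow> bool" where
  "linear_map n m E \<longleftrightarrow>
     (\<forall>X\<in>carrier_mat n n. E X \<in> carrier_mat m m) \<and>
     (\<forall>X\<in>carrier_mat n n. \<forall>Y\<in>carrier_mat n n. E (X + Y) = E X + E Y) \<and>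
     (\<forall>c. \<forall>X\<in>carrier_mat n n. E (c \<cdot>\<^sub>m X) = c \<cdot>\<^sub>m E X)"

text \<open>
  \<open>ampliation k n m E\<close> is \<open>id\<^sub>k \<otimes> E\<close>: it applies \<open>E\<close> to each of the \<open>k \<times> k\<close> blocks
  (of size \<open>n \<times> n\<close>) of its argument.
\<close>

definition ampliation ::
    "nat \<Rightarrow> nat \<Rightarrow> nat \<Rightarrow> (complex mat \<Rightarrow> complex mat) \<Rightarrow> complex mat \<Rightarrow> complex mat" where
  "ampliation k n m E X = mat (k * m) (k * m) (\<lambda>(r, s).
     E (mat n n (\<lambda>(a, b). X $$ (r div m * n + a, s div m * n + b))) $$ (r mod m, s mod m))"

definition completely_positive :: "nat \<Rightarrow> nat \<Rightarrow> (complex mat \<Rightarrow> complex mat) \<Rightarrow> bool" where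
  "completely_positive n m E \<longleftrightarrow>
     (\<forall>k. \<forall>X. psd (k * n) X \<longrightarrow> psd (k * m) (ampliation k n m E X))"

definition cptp :: "nat \<Rightarrow> nat \<Rightarrow> (complex mat \<Rightarrow> complex mat) \<Rightarrow> bool" where
  "cptp n m E \<longleftrightarrow> linear_map n m E \<and> completely_positive n m E \<and>
     (\<forall>X\<in>carrier_mat n n. mat_trace (E X) = mat_trace X)"


section \<open>Quantum divergences\<close>

definition quantum_divergence :: "(complex mat \<Rightarrow> complex mat \<Rightarrow> ereal) \<Rightarrow> bool" where
  "quantum_divergence D \<longleftrightarrow>
     (\<forall>n. \<forall>\<rho>\<in>density_ops n. \<forall>\<sigma>\<in>density_ops n. D \<rho> \<sigma> \<noteq> -\<infinity>) \<and>
     (\<forall>n m E. cptp n m E \<longrightarrow>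
        (\<forall>\<rho>\<in>density_ops n. \<forall>\<sigma>\<in>density_ops n. D (E \<rho>) (E \<sigma>) \<le> D \<rho> \<sigma>))"

definition unitary_mats :: "nat \<Rightarrow> complex mat set" where
  "unitary_mats n = {U \<in> carrier_mat n n. mat_adjoint U * U = 1\<^sub>m n \<and> U * mat_adjoint U = 1\<^sub>m n}"

definition diag_op :: "complex mat \<Rightarrow> real vec \<Rightarrow> complex mat" where
  "diag_op U p = U * mat_diag (dim_vec p) (\<lambda>x. complex_of_real (p $ x)) * mat_adjoint U"

definition quantum_extension ::
    "(real vec \<Rightarrow> real vec \<Rightarrow> ereal) \<Rightarrow> (complex mat \<Rightarrow> complex mat \<Rightarrow> ereal) \<Rightarrow> bool" where
  "quantum_extension C D \<longleftrightarrow> quantum_divergence D \<and>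
     (\<forall>n. \<forall>U\<in>unitary_mats n. \<forall>p\<in>prob_vecs n. \<forall>q\<in>prob_vecs n.
        D (diag_op U p) (diag_op U q) = C p q)"

definition povm :: "nat \<Rightarrow> nat \<Rightarrow> (nat \<Rightarrow> complex mat) \<Rightarrow> bool" where
  "povm n m M \<longleftrightarrow> (\<forall>x<m. psd n (M x)) \<and> mat n n (\<lambda>(i, j). \<Sum>x<m. M x $$ (i, j)) = 1\<^sub>m n"

definition outcome_dist :: "nat \<Rightarrow> (nat \<Rightarrow> complex mat) \<Rightarrow> complex mat \<Rightarrow> real vec" where
  "outcome_dist m M \<rho> = vec m (\<lambda>x. Re (mat_trace (M x * \<rho>)))"

definition measured_div ::
    "(real vec \<Rightarrow> real vec \<Rightarrow> ereal) \<Rightarrow> complex mat \<Rightarrow> complex mat \<Rightarrow> ereal" where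
  "measured_div C \<rho> \<sigma> =
     (SUP (m, M) \<in> {(m, M). povm (dim_row \<rho>) m M}. C (outcome_dist m M \<rho>) (outcome_dist m M \<sigma>))"

definition smoothing_ball :: "real \<Rightarrow> complex mat \<Rightarrow> complex mat set" where
  "smoothing_ball \<epsilon> \<rho> = {\<rho>' \<in> density_ops (dim_row \<rho>). 1 / 2 * trace_norm (\<rho> - \<rho>') \<le> \<epsilon>}"

definition smoothed_div ::
    "real \<Rightarrow> (complex mat \<Rightarrow> complex mat \<Rightarrow> ereal) \<Rightarrow> complex mat \<Rightarrow> complex mat \<Rightarrow> ereal" where
  "smoothed_div \<epsilon> D \<rho> \<sigma> = (INF \<rho>' \<in> smoothing_ball \<epsilon> \<rho>. D \<rho>' \<sigma>)"


section \<open>The optimal constant\<close>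

text \<open>
  Pairs with \<open>\<infinity> - \<infinity>\<close> are left out of the supremum, since they satisfy the
  inequality with every constant (in the library \<open>\<infinity> - \<infinity> = \<infinity>\<close> on \<open>ereal\<close>).  Lemma
  \<open>nu_le_iff\<close> below confirms that \<open>nu\<close> is the least constant for which it holds.
\<close>

definition nu :: "real \<Rightarrow> ereal \<Rightarrow> (complex mat \<Rightarrow> complex mat \<Rightarrow> ereal) \<Rightarrow> ereal" where
  "nu \<epsilon> \<alpha> D =
     (SUP (\<rho>, \<sigma>) \<in> {(\<rho>, \<sigma>). (\<exists>n. \<rho> \<in> density_ops n \<and> \<sigma> \<in> density_ops n) \<and>
                  \<not> (measured_div (renyi_div \<alpha>) \<rho> \<sigma> = \<infinity> \<and> smoothed_div \<epsilon> D \<rho> \<sigma> = \<infinity>)}.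
        measured_div (renyi_div \<alpha>) \<rho> \<sigma> - smoothed_div \<epsilon> D \<rho> \<sigma>)"

lemma renyi_div_not_MInfty: "renyi_div \<alpha> p q \<noteq> -\<infinity>"
  by (auto simp: renyi_div_def Let_def)

lemma psd_one: "psd n (1\<^sub>m n)"
  by (auto simp: psd_def conjugate_square_ge_0_vec)

lemma povm_trivial: "povm n 1 (\<lambda>_. 1\<^sub>m n)"
  by (auto simp: povm_def psd_one)

lemma measured_div_renyi_not_MInfty: "measured_div (renyi_div \<alpha>) \<rho> \<sigma> \<noteq> -\<infinity>"
proof -
  let ?M = "\<lambda>_::nat. 1\<^sub>m (dim_row \<rho>) :: complex mat"
  have "renyi_div \<alpha> (outcome_dist 1 ?M \<rho>) (outcome_dist 1 ?M \<sigma>) \<le> measured_div (renyi_div \<alpha>) \<rho> \<sigma>"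
    unfolding measured_div_def by (rule SUP_upper2[of "(1, ?M)"]) (auto intro: povm_trivial[simplified])
  then show ?thesis
    using renyi_div_not_MInfty[of \<alpha> "outcome_dist 1 ?M \<rho>" "outcome_dist 1 ?M \<sigma>"] by auto
qed

lemma nu_le_iff:
  "nu \<epsilon> \<alpha> D \<le> ereal r \<longleftrightarrow>
     (\<forall>n. \<forall>\<rho>\<in>density_ops n. \<forall>\<sigma>\<in>density_ops n.
        measured_div (renyi_div \<alpha>) \<rho> \<sigma> - ereal r \<le> smoothed_div \<epsilon> D \<rho> \<sigma>)"
proof -
  have *: "(\<not> (m = \<infinity> \<and> s = \<infinity>) \<longrightarrow> m - s \<le> ereal r) \<longleftrightarrow> m - ereal r \<le> s"
    if "m \<noteq> -\<infinity>" for m s :: ereal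
    using that by (cases m; cases s) auto
  show ?thesis
    unfolding nu_def SUP_le_iff
    by (auto simp: *[OF measured_div_renyi_not_MInfty, symmetric])
qed

end

theory Submission
  imports Defs "Jordan_Normal_Form.Spectral_Radius"
begin

text \<open>
  Upper bound.  Measuring reduces everything to distributions \<open>p\<close>, \<open>p'\<close>, \<open>q\<close>: the measurement
  channel does not increase the divergence, nor does it increase the trace distance.  The common
  part \<open>m = min p p'\<close> has mass at least \<open>1 - \<epsilon>\<close>.  As \<open>\<gamma> \<mapsto> ln (\<Sum>x. m x powr \<gamma> * q x powr (1 - \<gamma>))\<close>
  is convex and \<open>1\<close> lies between \<open>\<alpha>\<close> and \<open>\<beta>\<close>, this mass (the value at \<open>\<gamma> = 1\<close>) is bounded by the
  sums of orders \<open>\<alpha>\<close> and \<open>\<beta>\<close>, which in turn are bounded by those of \<open>p\<close> and \<open>p'\<close>.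

  Lower bounds.  Equality needs \<open>m\<close> proportional to \<open>q\<close> on its support, the \<open>\<epsilon>\<close>-part of \<open>p\<close> where \<open>q\<close>
  vanishes and that of \<open>p'\<close> where \<open>q\<close> is large, which leads to \<open>p = (1 - \<epsilon>, 0, \<epsilon>)\<close>,
  \<open>p' = (1 - \<epsilon>, \<epsilon>, 0)\<close> and \<open>q = (\<delta>, 1 - \<delta>, 0)\<close> with \<open>\<delta> \<rightarrow> 0\<close>.
\<close>

section \<open>Positive semidefinite matrices and the spectral theorem\<close>

lemma mat_adjoint_carrier [simp]: "A \<in> carrier_mat n m \<Longrightarrow> mat_adjoint A \<in> carrier_mat m n"
  by (auto simp: mat_adjoint_def)

lemma dim_mat_adjoint [simp]:
  "dim_row (mat_adjoint A) = dim_col A" "dim_col (mat_adjoint A) = dim_row A"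
  by (auto simp: mat_adjoint_def)

lemma index_mat_adjoint [simp]:
  "i < dim_col A \<Longrightarrow> j < dim_row A \<Longrightarrow> mat_adjoint A $$ (i, j) = conjugate (A $$ (j, i))"
  by (simp add: mat_adjoint_def mat_of_rows_index)

lemma mat_adjoint_adjoint [simp]: "mat_adjoint (mat_adjoint A) = A"
  by (rule eq_matI) auto

lemma mat_adjoint_mult:
  fixes A B :: "complex mat"
  assumes "A \<in> carrier_mat n m" "B \<in> carrier_mat m k"
  shows "mat_adjoint (A * B) = mat_adjoint B * mat_adjoint A"
  using assms by (intro eq_matI) (auto simp: scalar_prod_def intro!: sum.cong)

lemma mat_adjoint_one [simp]: "mat_adjoint (1\<^sub>m n :: complex mat) = 1\<^sub>m n"
  by (rule eq_matI) auto

lemma mat_adjoint_diag: "mat_adjoint (mat_diag n f :: complex mat) = mat_diag n (\<lambda>i. cnj (f i))"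
  by (rule eq_matI) (auto simp: mat_diag_def)

lemma cscalar_prod_mult_mat_vec:
  fixes A :: "complex mat"
  assumes "A \<in> carrier_mat n m" "v \<in> carrier_vec m" "w \<in> carrier_vec n"
  shows "(A *\<^sub>v v) \<bullet>c w = v \<bullet>c (mat_adjoint A *\<^sub>v w)"
proof -
  have "(A *\<^sub>v v) \<bullet>c w = (\<Sum>i<n. \<Sum>j<m. A $$ (i, j) * v $ j * cnj (w $ i))"
    using assms by (auto simp: scalar_prod_def atLeast0LessThan sum_distrib_right intro!: sum.cong)
  also have "\<dots> = (\<Sum>j<m. \<Sum>i<n. A $$ (i, j) * v $ j * cnj (w $ i))"
    by (rule sum.swap)
  also have "\<dots> = v \<bullet>c (mat_adjoint A *\<^sub>v w)"
    using assms by (auto simp: scalar_prod_def atLeast0LessThan sum_distrib_left intro!: sum.cong)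
  finally show ?thesis .
qed

lemma quadratic_form_expand:
  fixes A :: "complex mat"
  assumes "A \<in> carrier_mat n n" "v \<in> carrier_vec n"
  shows "(A *\<^sub>v v) \<bullet>c v = (\<Sum>i<n. \<Sum>j<n. cnj (v $ i) * A $$ (i, j) * v $ j)"
  using assms
  by (auto simp: scalar_prod_def atLeast0LessThan sum_distrib_left sum_distrib_right mult_ac intro!: sum.cong)

lemma psd_carrier: "psd n A \<Longrightarrow> A \<in> carrier_mat n n"
  by (simp add: psd_def)

text \<open>Quantifying over functions instead of carrier vectors lets test vectors be given by
  formulas: of small support, or indexed by blocks as in the proof of complete positivity.\<close>

lemma psd_iff_sum:
  "psd n A \<longleftrightarrow> A \<in> carrier_mat n n \<and>
     (\<forall>f. 0 \<le> (\<Sum>i<n. \<Sum>j<n. cnj (f i) * A $$ (i, j) * f j))"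
proof (cases "A \<in> carrier_mat n n")
  case True
  have "(\<forall>v\<in>carrier_vec n. 0 \<le> (A *\<^sub>v v) \<bullet>c v) \<longleftrightarrow>
        (\<forall>f. 0 \<le> (\<Sum>i<n. \<Sum>j<n. cnj (f i) * A $$ (i, j) * f j))" (is "?L \<longleftrightarrow> ?R")
  proof
    assume L: ?L
    show ?R
    proof
      fix f
      have "0 \<le> (A *\<^sub>v vec n f) \<bullet>c vec n f" using L by simp
      also have "\<dots> = (\<Sum>i<n. \<Sum>j<n. cnj (f i) * A $$ (i, j) * f j)"
        using True by (simp add: quadratic_form_expand)
      finally show "0 \<le> (\<Sum>i<n. \<Sum>j<n. cnj (f i) * A $$ (i, j) * f j)" .
    qed
  next
    assume ?R
    then show ?L using True by (simp add: quadratic_form_expand)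
  qed
  with True show ?thesis by (simp add: psd_def)
qed (simp add: psd_def)

text \<open>Polarisation: basis vectors show that the diagonal is real. Testing e_i + c e_j with c =
  1 and c = \<i> makes A_ij + A_ji and \<i> (A_ij - A_ji) real, so A_ji is the conjugate of
  A_ij.\<close>

lemma psd_hermitian:
  assumes "psd n A"
  shows "mat_adjoint A = A"
proof -
  have A: "A \<in> carrier_mat n n" using assms by (rule psd_carrier)
  have q: "0 \<le> (\<Sum>i<n. \<Sum>j<n. cnj (f i) * A $$ (i, j) * f j)" for f
    using assms by (auto simp: psd_iff_sum)
  have sub: "(\<Sum>i<n. \<Sum>j<n. cnj (f i) * A $$ (i, j) * f j) =
      (\<Sum>i\<in>S. \<Sum>j\<in>S. cnj (f i) * A $$ (i, j) * f j)"
    if "S \<subseteq> {..<n}" "\<And>i. i \<notin> S \<Longrightarrow> f i = 0" for S f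
  proof -
    have "(\<Sum>i<n. \<Sum>j<n. cnj (f i) * A $$ (i, j) * f j) =
      (\<Sum>i<n. \<Sum>j\<in>S. cnj (f i) * A $$ (i, j) * f j)"
      by (rule sum.cong[OF refl], rule sum.mono_neutral_right) (use that in auto)
    also have "\<dots> = (\<Sum>i\<in>S. \<Sum>j\<in>S. cnj (f i) * A $$ (i, j) * f j)"
      by (rule sum.mono_neutral_right) (use that in auto)
    finally show ?thesis .
  qed
  have diag: "0 \<le> A $$ (i, i)" if "i < n" for i
    using q[of "\<lambda>j. if j = i then 1 else 0"] sub[of "{i}" "\<lambda>j. if j = i then 1 else 0"] that by simp
  have "cnj (A $$ (j, i)) = A $$ (i, j)" if "i < n" "j < n" for i j
  proof (cases "i = j")
    case True
    then show ?thesis using diag[of i] that by (auto simp: less_eq_complex_def complex_eq_iff)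
  next
    case False
    have h: "0 \<le> A $$ (i, i) + A $$ (i, j) * c + cnj c * A $$ (j, i) + cnj c * A $$ (j, j) * c" for c
      using q[of "\<lambda>k. if k = i then 1 else if k = j then c else 0"]
        sub[of "{i,j}" "\<lambda>k. if k = i then 1 else if k = j then c else 0"] that False
      by (simp add: algebra_simps)
    from h[of 1] h[of \<i>] diag[of i] diag[of j] that
    show ?thesis by (auto simp: less_eq_complex_def complex_eq_iff)
  qed
  then show ?thesis using A by (intro eq_matI) auto
qed

section \<open>Unitary matrices and diagonalisation of Hermitian matrices\<close>

lemma unitary_matsD:
  assumes "U \<in> unitary_mats n"
  shows "U \<in> carrier_mat n n" "mat_adjoint U * U = 1\<^sub>m n" "U * mat_adjoint U = 1\<^sub>m n"
  using assms by (auto simp: unitary_mats_def)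

lemma unitary_matsI:
  assumes "U \<in> carrier_mat n n" "mat_adjoint U * U = 1\<^sub>m n"
  shows "U \<in> unitary_mats n"
  using assms mat_mult_left_right_inverse[of "mat_adjoint U" n U] by (auto simp: unitary_mats_def)

lemma one_unitary: "1\<^sub>m n \<in> unitary_mats n"
  by (auto simp: unitary_mats_def)

lemma unitary_mult:
  assumes "U \<in> unitary_mats n" "V \<in> unitary_mats n"
  shows "U * V \<in> unitary_mats n"
proof -
  note U = unitary_matsD[OF assms(1)] and V = unitary_matsD[OF assms(2)]
  have "mat_adjoint U * (U * V) = V"
    using U V by (simp add: assoc_mult_mat[of _ n n _ n _ n, symmetric])
  then have "mat_adjoint (U * V) * (U * V) = 1\<^sub>m n"
    using U(1) V by (simp add: mat_adjoint_mult[of _ n n _ n] assoc_mult_mat[of _ n n _ n _ n])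
  then show ?thesis using U V by (intro unitary_matsI) auto
qed

text \<open>Complete \<open>v\<close> to a basis and orthogonalise by Gram-Schmidt, which keeps the
  first vector. The factor \<open>c\<close> comes from normalisation; it does no harm to an
  eigenvector.\<close>

lemma nonzero_vector_extends_to_unitary:
  fixes v :: "complex vec"
  assumes v: "v \<in> carrier_vec n" and v0: "v \<noteq> 0\<^sub>v n"
  shows "\<exists>W\<in>unitary_mats n. \<exists>c. c \<noteq> 0 \<and> col W 0 = c \<cdot>\<^sub>v v"
proof -
  interpret cof_vec_space n "TYPE(complex)" .
  define b where "b = basis_completion v"
  define ws where "ws = gram_schmidt n b"
  from basis_completion[OF v v0, folded b_def]
  have b: "distinct b" "\<not> lin_dep (set b)" "set b \<subseteq> carrier_vec n" "hd b = v" "length b = n"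
    by auto
  have n: "n \<noteq> 0" using v v0 by (intro notI) auto
  from gram_schmidt_result[OF b(3,1,2) ws_def]
  have ws: "set ws \<subseteq> carrier_vec n" "corthogonal ws" "length ws = n" using b by auto
  have hdws: "hd ws = v" unfolding ws_def
    using b n v gram_schmidt_hd[of v "tl b"] by (cases b) auto
  have wsi: "ws ! i \<in> carrier_vec n" if "i < n" for i using ws that by auto
  \<comment> \<open>Gram-Schmidt leaves the vectors unnormalised, so each is divided by its
    norm.\<close>
  define c where "c w = complex_of_real (1 / sqrt (Re (w \<bullet>c w)))" for w :: "complex vec"
  define W where "W = mat_of_cols n (map (\<lambda>w. c w \<cdot>\<^sub>v w) ws)"
  have W: "W \<in> carrier_mat n n" unfolding W_def using ws by auto
  have colW: "col W i = c (ws ! i) \<cdot>\<^sub>v ws ! i" if "i < n" for i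
    unfolding W_def using that ws by (subst col_mat_of_cols) (auto simp: wsi)
  have pos: "0 < ws ! i \<bullet>c ws ! i" if "i < n" for i
    using corthogonalD[OF ws(2), of i i] that ws conjugate_square_ge_0_vec[of "ws ! i"]
    by (simp add: less_le)
  have c_sq: "cnj (c (ws ! i)) * (c (ws ! i) * (ws ! i \<bullet>c ws ! i)) = 1" if "i < n" for i
  proof -
    let ?r = "Re (ws ! i \<bullet>c ws ! i)"
    have r: "ws ! i \<bullet>c ws ! i = complex_of_real ?r" "?r > 0"
      using pos[OF that] by (auto simp: less_complex_def complex_eq_iff)
    then have "cnj (c (ws ! i)) * (c (ws ! i) * (ws ! i \<bullet>c ws ! i)) =
        complex_of_real (1 / sqrt ?r * (1 / sqrt ?r * ?r))"
      unfolding c_def by (metis complex_cnj_complex_of_real of_real_mult)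
    also have "1 / sqrt ?r * (1 / sqrt ?r * ?r) = 1"
      using r(2) by (simp add: field_simps)
    finally show ?thesis by simp
  qed
  have "mat_adjoint W * W = 1\<^sub>m n"
  proof (rule eq_matI)
    fix i j assume "i < dim_row (1\<^sub>m n :: complex mat)" "j < dim_col (1\<^sub>m n :: complex mat)"
    then have ij: "i < n" "j < n" by auto
    have "(mat_adjoint W * W) $$ (i, j) = conjugate (col W i) \<bullet> col W j"
      using ij W by (auto simp: mat_adjoint_def)
    also have "\<dots> = cnj (c (ws ! i)) * (c (ws ! j) * (ws ! j \<bullet>c ws ! i))"
      using ij wsi by (simp add: colW conjugate_smult_vec conjugate_vec_sprod_comm[of _ n]
          smult_scalar_prod_distrib[of _ n] scalar_prod_smult_distrib[of _ n])
    also have "\<dots> = (if i = j then 1 else 0)"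
      using c_sq[OF ij(1)] corthogonalD[OF ws(2), of j i] ij ws by auto
    finally show "(mat_adjoint W * W) $$ (i, j) = 1\<^sub>m n $$ (i, j)" using ij by simp
  qed (use W in auto)
  then have "W \<in> unitary_mats n" using W by (intro unitary_matsI)
  moreover have "col W 0 = c v \<cdot>\<^sub>v v"
    using colW[of 0] n hdws ws by (cases ws) auto
  moreover have "c v \<noteq> 0" using c_sq[of 0] n hdws ws by (cases ws) auto
  ultimately show ?thesis by blast
qed

text \<open>With a single dimension the goal determines the inner dimension too, so this works as a
  simplification rule.\<close>

lemma mult_carrier_mat_square [simp]:
  "A \<in> carrier_mat n n \<Longrightarrow> B \<in> carrier_mat n n \<Longrightarrow> A * B \<in> carrier_mat n n"
  by (rule mult_carrier_mat)

lemma mult_one_mat_square [simp]: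
  fixes A :: "'a :: semiring_1 mat"
  assumes "A \<in> carrier_mat n n"
  shows "1\<^sub>m n * A = A" "A * 1\<^sub>m n = A"
  using assms by (auto intro: left_mult_one_mat right_mult_one_mat)

lemma conj_hermitian:
  fixes A :: "complex mat"
  assumes "A \<in> carrier_mat n n" "mat_adjoint A = A" "W \<in> carrier_mat n n"
  shows "mat_adjoint (mat_adjoint W * A * W) = mat_adjoint W * A * W"
  using assms by (simp add: mat_adjoint_mult[of _ n n _ n] assoc_mult_mat[of _ n n _ n _ n])

lemma unitary_conj_cancel:
  assumes "W \<in> unitary_mats n" "A \<in> carrier_mat n n"
  shows "W * (mat_adjoint W * A * W) * mat_adjoint W = A"
proof -
  note W = unitary_matsD[OF assms(1)]
  have "W * (mat_adjoint W * A * W) * mat_adjoint W = (W * mat_adjoint W) * A * (W * mat_adjoint W)"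
    using W(1) assms(2) by (simp add: assoc_mult_mat[of _ n n _ n _ n])
  then show ?thesis using W assms by simp
qed

text \<open>Induction by deflation: a unitary \<open>W\<close> with an eigenvector as first column
  makes the first column of \<open>B\<close> a multiple of the first unit vector. Since
  \<open>B\<close> is Hermitian, its first row has the same shape, and the induction hypothesis
  handles the remaining block \<open>C\<close>.\<close>

theorem hermitian_unitary_diagonalization:
  fixes A :: "complex mat"
  assumes "A \<in> carrier_mat n n" "mat_adjoint A = A"
  shows "\<exists>U\<in>unitary_mats n. \<exists>d. dim_vec d = n \<and> A = diag_op U d"
  using assms
proof (induction n arbitrary: A)
  case 0
  then show ?case
    by (intro bexI[of _ "1\<^sub>m 0"] exI[of _ "vec 0 (\<lambda>_. 0)"] conjI eq_matI)
      (auto simp: diag_op_def one_unitary mat_diag_def)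
next
  case (Suc n)
  obtain e v where "eigenvector A v e"
    using spectrum_non_empty[OF Suc.prems(1)] by (auto simp: spectrum_def eigenvalue_def)
  then have v: "v \<in> carrier_vec (Suc n)" "v \<noteq> 0\<^sub>v (Suc n)" "A *\<^sub>v v = e \<cdot>\<^sub>v v"
    using Suc.prems by (auto simp: eigenvector_def)
  obtain W c where W: "W \<in> unitary_mats (Suc n)" and c: "c \<noteq> 0" "col W 0 = c \<cdot>\<^sub>v v"
    using nonzero_vector_extends_to_unitary[OF v(1,2)] by blast
  note W' = unitary_matsD[OF W]
  have AW: "A *\<^sub>v col W 0 = e \<cdot>\<^sub>v col W 0"
    using v Suc.prems by (simp add: c mult_mat_vec[of _ "Suc n" "Suc n"] smult_smult_assoc mult.commute)
  define B where "B = mat_adjoint W * A * W"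
  have B: "B \<in> carrier_mat (Suc n) (Suc n)" using W'(1) Suc.prems by (simp add: B_def)
  have Bherm: "mat_adjoint B = B"
    unfolding B_def using Suc.prems W'(1) by (rule conj_hermitian)
  have col0: "B $$ (i, 0) = (if i = 0 then e else 0)" if "i < Suc n" for i
  proof -
    have "B = mat_adjoint W * (A * W)"
      using W'(1) Suc.prems by (simp add: B_def assoc_mult_mat[of _ "Suc n" "Suc n" _ "Suc n" _ "Suc n"])
    then have "B $$ (i, 0) = row (mat_adjoint W) i \<bullet> col (A * W) 0"
      using that W'(1) Suc.prems by simp
    also have "col (A * W) 0 = e \<cdot>\<^sub>v col W 0"
      unfolding AW[symmetric] using W'(1) Suc.prems by (intro col_mult2[of _ "Suc n" "Suc n" _ "Suc n"]) auto
    also have "row (mat_adjoint W) i \<bullet> (e \<cdot>\<^sub>v col W 0) = e * (row (mat_adjoint W) i \<bullet> col W 0)"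
      using W'(1) that by (intro scalar_prod_smult_distrib[of _ "Suc n"]) (auto intro!: carrier_vecI)
    also have "row (mat_adjoint W) i \<bullet> col W 0 = (mat_adjoint W * W) $$ (i, 0)"
      using W'(1) that by simp
    also have "\<dots> = (if i = 0 then 1 else 0)" unfolding W'(2) using that by simp
    finally show ?thesis by simp
  qed
  \<comment> \<open>Hermitian symmetry carries the zeros of the first column over to the first row;
    at the corner it shows that \<open>e\<close> is real, so \<open>Re e\<close> can serve as a
    diagonal entry.\<close>
  have row0: "B $$ (0, i) = (if i = 0 then e else 0)" "cnj e = e" if "i < Suc n" for i
  proof -
    have "B $$ (0, i) = cnj (B $$ (i, 0))" if "i < Suc n" for i
      using B that by (subst Bherm[symmetric]) simp
    from this[OF that] this[of 0] show "B $$ (0, i) = (if i = 0 then e else 0)" "cnj e = e"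
      using col0[OF that] col0[of 0] by (auto split: if_splits)
  qed
  define C where "C = mat n n (\<lambda>(i, j). B $$ (Suc i, Suc j))"
  have C: "C \<in> carrier_mat n n" by (simp add: C_def)
  have "cnj (B $$ (j, i)) = B $$ (i, j)" if "i < Suc n" "j < Suc n" for i j
    using arg_cong[OF Bherm, of "\<lambda>M. M $$ (i, j)"] B that by simp
  then have "mat_adjoint C = C"
    by (intro eq_matI) (auto simp: C_def)
  from Suc.IH[OF C this] obtain U d where U: "U \<in> unitary_mats n" and d: "dim_vec d = n" "C = diag_op U d"
    by blast
  note U' = unitary_matsD[OF U]
  let ?D = "\<lambda>x. mat_diag (dim_vec x) (\<lambda>i. complex_of_real (x $ i))"
  \<comment> \<open>The direct sum of 1 and \<open>U\<close> diagonalises the block \<open>e\<close>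
    and the block \<open>C\<close> together.\<close>
  define V where "V = four_block_mat (1\<^sub>m 1) (0\<^sub>m 1 n) (0\<^sub>m n 1) U"
  define d' where "d' = vCons (Re e) d"
  have V: "V \<in> carrier_mat (Suc n) (Suc n)" using U'(1) by (auto simp: V_def)
  have Vadj: "mat_adjoint V = four_block_mat (1\<^sub>m 1) (0\<^sub>m 1 n) (0\<^sub>m n 1) (mat_adjoint U)"
    using U'(1) by (auto simp: V_def intro!: eq_matI)
  have "mat_adjoint V * V = four_block_mat (1\<^sub>m 1) (0\<^sub>m 1 n) (0\<^sub>m n 1) (1\<^sub>m n)"
    unfolding Vadj unfolding V_def using U'
    by (subst mult_four_block_mat[of _ 1 1 _ n _ n _ _ 1 _ n]) auto
  also have "\<dots> = 1\<^sub>m (Suc n)" by (auto intro!: eq_matI)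
  finally have Vu: "V \<in> unitary_mats (Suc n)" using V by (intro unitary_matsI)
  have dim_d': "dim_vec d' = Suc n" using d by (simp add: d'_def)
  have "?D d' = four_block_mat (mat 1 1 (\<lambda>_. e)) (0\<^sub>m 1 n) (0\<^sub>m n 1) (?D d)"
    unfolding dim_d' using d row0(2)[of 0]
    by (intro eq_matI) (auto simp: d'_def mat_diag_def complex_eq_iff not_less_eq vec_index_vCons)
  then have "diag_op V d' = four_block_mat (1\<^sub>m 1) (0\<^sub>m 1 n) (0\<^sub>m n 1) U *
     four_block_mat (mat 1 1 (\<lambda>_. e)) (0\<^sub>m 1 n) (0\<^sub>m n 1) (?D d) * mat_adjoint V"
    by (simp add: diag_op_def V_def)
  also have "\<dots> = four_block_mat (mat 1 1 (\<lambda>_. e)) (0\<^sub>m 1 n) (0\<^sub>m n 1) (U * ?D d) * mat_adjoint V"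
    using U'(1) d mat_diag_dim[of n "\<lambda>i. complex_of_real (d $ i)"]
    by (subst mult_four_block_mat[of _ 1 1 _ n _ n _ _ 1 _ n]) (auto intro!: cong_four_block_mat simp: left_mult_zero_mat[OF mat_diag_dim])
  also have "\<dots> = four_block_mat (mat 1 1 (\<lambda>_. e)) (0\<^sub>m 1 n) (0\<^sub>m n 1) C"
    unfolding Vadj using U'(1) d mat_diag_dim[of n "\<lambda>i. complex_of_real (d $ i)"]
    by (subst mult_four_block_mat[of _ 1 1 _ n _ n _ _ 1 _ n])
      (auto intro!: cong_four_block_mat simp: diag_op_def)
  also have "\<dots> = B"
  proof (rule eq_matI)
    fix i j assume "i < dim_row B" "j < dim_col B"
    then show "four_block_mat (mat 1 1 (\<lambda>_. e)) (0\<^sub>m 1 n) (0\<^sub>m n 1) C $$ (i, j) = B $$ (i, j)"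
      using B row0(1)[of j] col0[of i] by (cases i; cases j) (auto simp: C_def)
  qed (use B C in auto)
  finally have BV: "B = diag_op V d'" by simp
  have "A = W * B * mat_adjoint W"
    unfolding B_def using unitary_conj_cancel[OF W Suc.prems(1)] by simp
  also have "\<dots> = diag_op (W * V) d'"
    unfolding BV diag_op_def dim_d' using V W'(1) mat_diag_dim[of "Suc n" "\<lambda>i. complex_of_real (d' $ i)"]
    by (simp add: mat_adjoint_mult[of _ "Suc n" "Suc n" _ "Suc n"] assoc_mult_mat[of _ "Suc n" "Suc n" _ "Suc n" _ "Suc n"])
  finally show ?case using unitary_mult[OF W Vu] dim_d' by blast
qed

section \<open>Square roots and the trace norm\<close>

lemma mat_diag_of_real_vec [simp]:
  "mat_diag n (\<lambda>i. complex_of_real (vec n f $ i)) = mat_diag n (\<lambda>i. complex_of_real (f i))"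
  by (auto simp: mat_diag_def intro!: eq_matI)

lemma diag_op_carrier [simp]:
  "U \<in> carrier_mat n n \<Longrightarrow> dim_vec d = n \<Longrightarrow> diag_op U d \<in> carrier_mat n n"
  by (simp add: diag_op_def)

lemma diag_op_one: "diag_op (1\<^sub>m (dim_vec d)) d = mat_diag (dim_vec d) (\<lambda>x. complex_of_real (d $ x))"
  by (simp add: diag_op_def)

lemma diag_op_adjoint:
  assumes "U \<in> carrier_mat n n" "dim_vec d = n"
  shows "mat_adjoint (diag_op U d) = diag_op U d"
  using assms
  by (simp add: diag_op_def mat_adjoint_mult[of _ n n _ n] assoc_mult_mat[of _ n n _ n _ n] mat_adjoint_diag)

lemma diag_op_mult:
  assumes "U \<in> unitary_mats n" "dim_vec d = n" "dim_vec e = n"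
  shows "diag_op U d * diag_op U e = diag_op U (vec n (\<lambda>i. d $ i * e $ i))"
proof -
  note U = unitary_matsD[OF assms(1)]
  let ?D = "\<lambda>d. mat_diag n (\<lambda>i. complex_of_real (d $ i))"
  have "diag_op U d * diag_op U e = U * ?D d * (mat_adjoint U * U) * ?D e * mat_adjoint U"
    using assms U(1) by (simp add: diag_op_def assoc_mult_mat[of _ n n _ n _ n])
  also have "\<dots> = U * (?D d * ?D e) * mat_adjoint U"
    using U by (simp add: assoc_mult_mat[of _ n n _ n _ n] del: mat_diag_diag)
  also have "?D d * ?D e = ?D (vec n (\<lambda>i. d $ i * e $ i))"
    unfolding mat_diag_diag by (auto simp: mat_diag_def intro!: eq_matI)
  finally show ?thesis by (simp add: diag_op_def)
qed

lemma psd_diagonal_nonneg: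
  assumes "psd n A" "i < n"
  shows "0 \<le> A $$ (i, i)"
proof -
  have "A \<in> carrier_mat n n" using assms by (simp add: psd_def)
  moreover have "0 \<le> (A *\<^sub>v unit_vec n i) \<bullet>c unit_vec n i"
    using assms by (simp add: psd_def)
  moreover have "conjugate (unit_vec n i) = (unit_vec n i :: complex vec)"
    by (rule eq_vecI) (auto simp: unit_vec_def)
  ultimately show ?thesis using assms by simp
qed

lemma psd_conj:
  assumes "psd n A" "W \<in> carrier_mat n n"
  shows "psd n (mat_adjoint W * A * W)"
  unfolding psd_def
proof (intro conjI ballI)
  note A = psd_carrier[OF assms(1)]
  then show "mat_adjoint W * A * W \<in> carrier_mat n n" using assms by simp
  fix v :: "complex vec" assume v: "v \<in> carrier_vec n"
  then have Wv: "W *\<^sub>v v \<in> carrier_vec n" using assms by (simp add: mult_mat_vec_carrier[of _ n n])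
  have "((mat_adjoint W * A * W) *\<^sub>v v) \<bullet>c v = (mat_adjoint W *\<^sub>v (A *\<^sub>v (W *\<^sub>v v))) \<bullet>c v"
    using A assms v Wv by (simp add: assoc_mult_mat_vec[of _ n n _ n])
  also have "\<dots> = (A *\<^sub>v (W *\<^sub>v v)) \<bullet>c (W *\<^sub>v v)"
    using A assms v Wv by (subst cscalar_prod_mult_mat_vec[of _ n n]) (auto intro!: mult_mat_vec_carrier[of _ n n])
  also have "0 \<le> \<dots>" using assms Wv by (simp add: psd_def)
  finally show "0 \<le> ((mat_adjoint W * A * W) *\<^sub>v v) \<bullet>c v" .
qed

lemma psd_mat_diag:
  assumes "\<And>i. i < n \<Longrightarrow> 0 \<le> f i"
  shows "psd n (mat_diag n f)"
  unfolding psd_iff_sum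
proof (intro conjI allI)
  fix g
  have "(\<Sum>i<n. \<Sum>j<n. cnj (g i) * mat_diag n f $$ (i, j) * g j) = (\<Sum>i<n. f i * (cnj (g i) * g i))"
    by (intro sum.cong[OF refl]) (simp add: mat_diag_def if_distrib if_distribR cong: if_cong)
  also have "0 \<le> \<dots>"
  proof (rule sum_nonneg)
    fix i assume "i \<in> {..<n}"
    moreover have "0 \<le> cnj (g i) * g i"
      using conjugate_square_positive[of "g i"] by (simp add: mult.commute)
    ultimately show "0 \<le> f i * (cnj (g i) * g i)"
      using assms by (simp add: mult_nonneg_nonneg)
  qed
  finally show "0 \<le> (\<Sum>i<n. \<Sum>j<n. cnj (g i) * mat_diag n f $$ (i, j) * g j)" .
qed simp

lemma psd_diag_op:
  assumes "U \<in> carrier_mat n n" "dim_vec d = n" "\<And>i. i < n \<Longrightarrow> 0 \<le> d $ i"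
  shows "psd n (diag_op U d)"
proof -
  have "psd n (mat_diag n (\<lambda>i. complex_of_real (d $ i)))"
    using assms by (intro psd_mat_diag) (auto simp: less_eq_complex_def)
  from psd_conj[OF this, of "mat_adjoint U"] show ?thesis
    using assms by (simp add: diag_op_def)
qed

lemma diag_op_conj:
  assumes "U \<in> unitary_mats n" "dim_vec d = n"
  shows "mat_adjoint U * diag_op U d * U = mat_diag n (\<lambda>i. complex_of_real (d $ i))"
proof -
  note U = unitary_matsD[OF assms(1)]
  have "mat_adjoint U * diag_op U d * U =
    (mat_adjoint U * U) * mat_diag n (\<lambda>i. complex_of_real (d $ i)) * (mat_adjoint U * U)"
    using assms U(1) by (simp add: diag_op_def assoc_mult_mat[of _ n n _ n _ n])
  then show ?thesis using U by simp
qed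

lemma psd_diag_opD:
  assumes "psd n (diag_op U d)" "U \<in> unitary_mats n" "dim_vec d = n" "i < n"
  shows "0 \<le> d $ i"
  using psd_diagonal_nonneg[OF psd_conj[OF assms(1) unitary_matsD(1)[OF assms(2)]] assms(4)] assms
  by (simp add: diag_op_conj mat_diag_def less_eq_complex_def)

lemma psd_spectral:
  assumes "psd n A"
  obtains U d where "U \<in> unitary_mats n" "dim_vec d = n" "\<And>i. i < n \<Longrightarrow> 0 \<le> d $ i" "A = diag_op U d"
  using hermitian_unitary_diagonalization[OF psd_carrier[OF assms] psd_hermitian[OF assms]]
    psd_diag_opD assms by metis

text \<open>
  With \<open>S = U diag(s) U\<^sup>*\<close>, \<open>T = V diag(t) V\<^sup>*\<close> and \<open>W = V\<^sup>* U\<close>, equality of squares gives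
  \<open>(t\<^sub>i\<^sup>2 - s\<^sub>j\<^sup>2) W\<^sub>i\<^sub>j = 0\<close>, hence \<open>(t\<^sub>i - s\<^sub>j) W\<^sub>i\<^sub>j = 0\<close>.
\<close>

lemma psd_square_inj:
  assumes S: "psd n S" and T: "psd n T" and eq: "S * S = T * T"
  shows "S = T"
proof -
  obtain U s where U: "U \<in> unitary_mats n" and s: "dim_vec s = n" "\<And>i. i < n \<Longrightarrow> 0 \<le> s $ i"
    and S_eq: "S = diag_op U s" using psd_spectral[OF S] by metis
  obtain V t where V: "V \<in> unitary_mats n" and t: "dim_vec t = n" "\<And>i. i < n \<Longrightarrow> 0 \<le> t $ i"
    and T_eq: "T = diag_op V t" using psd_spectral[OF T] by metis
  note U' = unitary_matsD[OF U] and V' = unitary_matsD[OF V]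
  define W where "W = mat_adjoint V * U"
  have W: "W \<in> carrier_mat n n" using U' V' by (simp add: W_def)
  let ?D = "\<lambda>f. mat_diag n (\<lambda>i. complex_of_real (f i))"
  have left: "mat_adjoint V * diag_op U f * U = W * ?D (($) f)" if "dim_vec f = n" for f
  proof -
    have "mat_adjoint V * diag_op U f * U = W * ?D (($) f) * (mat_adjoint U * U)"
      using U'(1) V'(1) that by (simp add: diag_op_def W_def assoc_mult_mat[of _ n n _ n _ n])
    then show ?thesis using U' W by simp
  qed
  have right: "mat_adjoint V * diag_op V f * U = ?D (($) f) * W" if "dim_vec f = n" for f
  proof -
    have "mat_adjoint V * diag_op V f * U = (mat_adjoint V * V) * ?D (($) f) * W"
      using U'(1) V'(1) that by (simp add: diag_op_def W_def assoc_mult_mat[of _ n n _ n _ n])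
    then show ?thesis using V' W by simp
  qed
  have "W * ?D (\<lambda>i. s $ i * s $ i) = mat_adjoint V * (S * S) * U"
    using U s by (simp add: S_eq diag_op_mult left flip: of_real_mult)
  also have "\<dots> = ?D (\<lambda>i. t $ i * t $ i) * W"
    using V t by (simp add: eq T_eq diag_op_mult right flip: of_real_mult)
  finally have sq: "W $$ (i, j) * complex_of_real (s $ j * s $ j) =
      complex_of_real (t $ i * t $ i) * W $$ (i, j)" if "i < n" "j < n" for i j
    using that W mat_diag_mult_right[OF W] mat_diag_mult_left[OF W]
    by (metis (no_types, lifting) case_prod_conv index_mat(1))
  have "W $$ (i, j) * complex_of_real (s $ j) = complex_of_real (t $ i) * W $$ (i, j)"
    if "i < n" "j < n" for i j
  proof -
    have "W $$ (i, j) = 0 \<or> s $ j * s $ j = t $ i * t $ i"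
      using sq[OF that] by (metis mult.commute mult_right_cancel of_real_eq_iff)
    \<comment> \<open>Equal squares give \<open>s $ j = t $ i\<close> because both are
      nonnegative.\<close>
    then show ?thesis
      using s(2)[OF that(2)] t(2)[OF that(1)] by (auto simp: power2_eq_square[symmetric])
  qed
  then have "W * ?D (($) s) = ?D (($) t) * W"
    unfolding mat_diag_mult_right[OF W] mat_diag_mult_left[OF W] by (auto intro!: eq_matI)
  then have "mat_adjoint V * S * U = mat_adjoint V * T * U"
    using left[OF s(1)] right[OF t(1)] by (simp add: S_eq T_eq)
  then have "V * (mat_adjoint V * S * U) * mat_adjoint U = V * (mat_adjoint V * T * U) * mat_adjoint U"
    by simp
  moreover have "V * (mat_adjoint V * X * U) * mat_adjoint U = X" if "X \<in> carrier_mat n n" for X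
  proof -
    have "V * (mat_adjoint V * X * U) * mat_adjoint U = (V * mat_adjoint V) * X * (U * mat_adjoint U)"
      using U'(1) V'(1) that by (simp add: assoc_mult_mat[of _ n n _ n _ n])
    then show ?thesis using U' V' that by simp
  qed
  ultimately show ?thesis using psd_carrier[OF S] psd_carrier[OF T] by simp
qed

text \<open>Uniqueness of the positive root gives the \<open>THE\<close> in \<open>psd_sqrt\<close>
  its value, so a trace norm can be computed by exhibiting a root.\<close>

lemma psd_sqrt_square:
  assumes "psd n S"
  shows "psd_sqrt n (S * S) = S"
  unfolding psd_sqrt_def using assms by (intro the_equality) (auto intro: psd_square_inj)

section \<open>Traces and the trace norm of Hermitian operators\<close>

lemma mat_trace_mult:
  assumes "A \<in> carrier_mat n m" "B \<in> carrier_mat m n"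
  shows "mat_trace (A * B) = (\<Sum>i<n. \<Sum>j<m. A $$ (i, j) * B $$ (j, i))"
  using assms by (simp add: mat_trace_def scalar_prod_def atLeast0LessThan)

lemma mat_trace_mult_comm:
  assumes "A \<in> carrier_mat n m" "B \<in> carrier_mat m n"
  shows "mat_trace (A * B) = mat_trace (B * A)"
  unfolding mat_trace_mult[OF assms] mat_trace_mult[OF assms(2,1)]
  by (subst sum.swap) (simp add: mult.commute)

text \<open>By cyclicity of the trace only the diagonal of \<open>A\<close> in the basis
  \<open>U\<close> meets \<open>d\<close>. For a POVM element \<open>A\<close> these entries are
  outcome probabilities on the eigenvectors.\<close>

lemma mat_trace_mult_diag_op:
  assumes "A \<in> carrier_mat n n" "U \<in> carrier_mat n n" "dim_vec d = n"
  shows "mat_trace (A * diag_op U d) =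
    (\<Sum>i<n. (mat_adjoint U * A * U) $$ (i, i) * complex_of_real (d $ i))"
proof -
  let ?D = "mat_diag n (\<lambda>i. complex_of_real (d $ i))"
  have "mat_trace (A * diag_op U d) = mat_trace ((A * U * ?D) * mat_adjoint U)"
    using assms by (simp add: diag_op_def assoc_mult_mat[of _ n n _ n _ n])
  also have "\<dots> = mat_trace (mat_adjoint U * (A * U * ?D))"
    using assms by (intro mat_trace_mult_comm[of _ n n]) auto
  also have "mat_adjoint U * (A * U * ?D) = (mat_adjoint U * A * U) * ?D"
    using assms by (simp add: assoc_mult_mat[of _ n n _ n _ n])
  also have "mat_trace \<dots> = (\<Sum>i<n. (mat_adjoint U * A * U) $$ (i, i) * complex_of_real (d $ i))"
    using assms by (subst mat_diag_mult_right[of _ n]) (auto simp: mat_trace_def)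
  finally show ?thesis .
qed

lemma mat_trace_diag_op:
  assumes "U \<in> unitary_mats n" "dim_vec d = n"
  shows "mat_trace (diag_op U d) = complex_of_real (\<Sum>i<n. d $ i)"
  using mat_trace_mult_diag_op[of "1\<^sub>m n" n U d] assms unitary_matsD[OF assms(1)] by simp

text \<open>The operator with eigenvalues \<open>\<bar>d $ i\<bar>\<close> is positive and squares
  to the square of \<open>diag_op U d\<close>, so it is the root in the definition.\<close>

lemma trace_norm_diag_op:
  assumes "U \<in> unitary_mats n" "dim_vec d = n"
  shows "trace_norm (diag_op U d) = (\<Sum>i<n. \<bar>d $ i\<bar>)"
proof -
  note U = unitary_matsD[OF assms(1)]
  let ?S = "diag_op U (vec n (\<lambda>i. \<bar>d $ i\<bar>))"
  have "vec n (\<lambda>i. vec n (\<lambda>i. \<bar>d $ i\<bar>) $ i * vec n (\<lambda>i. \<bar>d $ i\<bar>) $ i) = vec n (\<lambda>i. d $ i * d $ i)"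
    by (rule eq_vecI) auto
  then have "mat_adjoint (diag_op U d) * diag_op U d = ?S * ?S"
    using assms U(1) by (simp add: diag_op_adjoint diag_op_mult)
  moreover have "psd n ?S" using U by (intro psd_diag_op) auto
  moreover have "dim_col (diag_op U d) = n" using diag_op_carrier[OF U(1) assms(2)] by simp
  ultimately show ?thesis
    using assms by (simp add: trace_norm_def psd_sqrt_square mat_trace_diag_op)
qed

section \<open>POVMs and contraction of the trace norm\<close>

lemma povmD:
  assumes "povm n m M"
  shows "\<And>x. x < m \<Longrightarrow> psd n (M x)" "\<And>x. x < m \<Longrightarrow> M x \<in> carrier_mat n n"
    "\<And>i j. i < n \<Longrightarrow> j < n \<Longrightarrow> (\<Sum>x<m. M x $$ (i, j)) = (if i = j then 1 else 0)"
proof -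
  show "psd n (M x)" if "x < m" for x using assms that by (simp add: povm_def)
  then show "M x \<in> carrier_mat n n" if "x < m" for x using that psd_carrier by blast
  show "(\<Sum>x<m. M x $$ (i, j)) = (if i = j then 1 else 0)" if "i < n" "j < n" for i j
  proof -
    have "mat n n (\<lambda>(i, j). \<Sum>x<m. M x $$ (i, j)) $$ (i, j) = 1\<^sub>m n $$ (i, j)"
      using assms by (simp add: povm_def)
    then show ?thesis using that by simp
  qed
qed

lemma index_conj:
  fixes A :: "complex mat"
  assumes "A \<in> carrier_mat n n" "W \<in> carrier_mat n n" "i < n" "j < n"
  shows "(mat_adjoint W * A * W) $$ (i, j) = (\<Sum>b<n. \<Sum>a<n. cnj (W $$ (a, i)) * A $$ (a, b) * W $$ (b, j))"
  using assms by (simp add: scalar_prod_def atLeast0LessThan sum_distrib_right)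

text \<open>Completeness of the POVM survives a change of basis. Together with positivity, each
  basis vector thus yields a probability distribution over the outcomes.\<close>

lemma povm_conj_sum:
  assumes "povm n m M" "U \<in> unitary_mats n" "i < n"
  shows "(\<Sum>x<m. (mat_adjoint U * M x * U) $$ (i, i)) = 1"
proof -
  note U = unitary_matsD[OF assms(2)] and M = povmD[OF assms(1)]
  have "(\<Sum>x<m. (mat_adjoint U * M x * U) $$ (i, i)) =
      (\<Sum>x<m. \<Sum>b<n. \<Sum>a<n. cnj (U $$ (a, i)) * M x $$ (a, b) * U $$ (b, i))"
    by (intro sum.cong[OF refl] index_conj) (use U M assms in auto)
  also have "\<dots> = (\<Sum>b<n. \<Sum>a<n. \<Sum>x<m. cnj (U $$ (a, i)) * M x $$ (a, b) * U $$ (b, i))"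
    by (subst sum.swap, intro sum.cong[OF refl], rule sum.swap)
  also have "\<dots> = (\<Sum>b<n. \<Sum>a<n. cnj (U $$ (a, i)) * 1\<^sub>m n $$ (a, b) * U $$ (b, i))"
    by (intro sum.cong[OF refl]) (simp add: sum_distrib_left[symmetric] sum_distrib_right[symmetric] M(3))
  also have "\<dots> = (mat_adjoint U * 1\<^sub>m n * U) $$ (i, i)"
    using U assms by (intro index_conj[symmetric]) auto
  also have "\<dots> = 1" using U assms by simp
  finally show ?thesis .
qed

text \<open>In an eigenbasis of \<open>X\<close>, the weight \<open>k x i\<close> is the probability
  of outcome \<open>x\<close> on eigenvector \<open>i\<close>. This stochastic kernel contracts the
  l1 norm of the eigenvalues, which is the trace norm.\<close>

lemma measured_l1_le_trace_norm:
  assumes M: "povm n m M" and X: "X \<in> carrier_mat n n" "mat_adjoint X = X"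
  shows "(\<Sum>x<m. \<bar>Re (mat_trace (M x * X))\<bar>) \<le> trace_norm X"
proof -
  obtain U d where U: "U \<in> unitary_mats n" and d: "dim_vec d = n" and X_eq: "X = diag_op U d"
    using hermitian_unitary_diagonalization[OF X] by blast
  note U' = unitary_matsD[OF U] and M' = povmD[OF M]
  define k where "k x i = Re ((mat_adjoint U * M x * U) $$ (i, i))" for x i
  have k_nonneg: "0 \<le> k x i" if "x < m" "i < n" for x i
    using psd_diagonal_nonneg[OF psd_conj[OF M'(1) U'(1)]] that
    by (simp add: k_def less_eq_complex_def)
  have k_sum: "(\<Sum>x<m. k x i) = 1" if "i < n" for i
    unfolding k_def using povm_conj_sum[OF M U that] by (metis Re_sum one_complex.sel(1))
  have "(\<Sum>x<m. \<bar>Re (mat_trace (M x * X))\<bar>) = (\<Sum>x<m. \<bar>\<Sum>i<n. k x i * d $ i\<bar>)"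
    unfolding X_eq using d M'(2) U'(1)
    by (simp add: mat_trace_mult_diag_op[of _ n U d] k_def del: index_mult_mat)
  also have "\<dots> \<le> (\<Sum>x<m. \<Sum>i<n. k x i * \<bar>d $ i\<bar>)"
    by (intro sum_mono order.trans[OF sum_abs]) (auto simp: abs_mult k_nonneg)
  also have "\<dots> = (\<Sum>i<n. (\<Sum>x<m. k x i) * \<bar>d $ i\<bar>)"
    unfolding sum_distrib_right by (rule sum.swap)
  also have "\<dots> = trace_norm X"
    unfolding X_eq using U d by (simp add: k_sum trace_norm_diag_op)
  finally show ?thesis .
qed

section \<open>Measurement channels\<close>

lemma mat_trace_psd_mult_nonneg:
  assumes "psd n A" "psd n B"
  shows "0 \<le> mat_trace (A * B)"
proof -
  obtain U d where U: "U \<in> unitary_mats n" and d: "dim_vec d = n" "\<And>i. i < n \<Longrightarrow> 0 \<le> d $ i"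
    and B_eq: "B = diag_op U d" using psd_spectral[OF assms(2)] by metis
  note U' = unitary_matsD[OF U]
  have "0 \<le> (\<Sum>i<n. (mat_adjoint U * A * U) $$ (i, i) * complex_of_real (d $ i))"
    using d psd_diagonal_nonneg[OF psd_conj[OF assms(1) U'(1)]]
    by (intro sum_nonneg mult_nonneg_nonneg) (auto simp: less_eq_complex_def)
  then show ?thesis
    unfolding B_eq mat_trace_mult_diag_op[OF psd_carrier[OF assms(1)] U'(1) d(1)] .
qed

lemma povm_trace_sum:
  assumes "povm n m M" "X \<in> carrier_mat n n"
  shows "(\<Sum>x<m. mat_trace (M x * X)) = mat_trace X"
proof -
  note M = povmD[OF assms(1)]
  have "(\<Sum>x<m. mat_trace (M x * X)) = (\<Sum>x<m. \<Sum>a<n. \<Sum>b<n. M x $$ (a, b) * X $$ (b, a))"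
    using M(2) assms(2) by (intro sum.cong[OF refl] mat_trace_mult) auto
  also have "\<dots> = (\<Sum>a<n. \<Sum>b<n. \<Sum>x<m. M x $$ (a, b) * X $$ (b, a))"
    by (subst sum.swap, intro sum.cong[OF refl], rule sum.swap)
  also have "\<dots> = (\<Sum>a<n. \<Sum>b<n. (if a = b then 1 else 0) * X $$ (b, a))"
    by (intro sum.cong[OF refl]) (simp add: M(3) flip: sum_distrib_right)
  also have "\<dots> = mat_trace X"
    using assms(2) by (simp add: mat_trace_def if_distribR if_distrib[of "\<lambda>x. x * _"] cong: if_cong)
  finally show ?thesis .
qed

lemma density_opsD:
  assumes "\<rho> \<in> density_ops n"
  shows "psd n \<rho>" "\<rho> \<in> carrier_mat n n" "mat_adjoint \<rho> = \<rho>" "mat_trace \<rho> = 1" "dim_row \<rho> = n"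
  using assms psd_carrier[of n \<rho>] psd_hermitian[of n \<rho>] by (auto simp: density_ops_def)

text \<open>By the second claim the trace is already real, so the \<open>Re\<close> in
  \<open>outcome_dist\<close> loses nothing.\<close>

lemma outcome_dist_nonneg:
  assumes "povm n m M" "\<rho> \<in> density_ops n" "x < m"
  shows "0 \<le> outcome_dist m M \<rho> $ x" "complex_of_real (outcome_dist m M \<rho> $ x) = mat_trace (M x * \<rho>)"
  using mat_trace_psd_mult_nonneg[OF povmD(1)[OF assms(1,3)] density_opsD(1)[OF assms(2)]] assms(3)
  by (auto simp: outcome_dist_def less_eq_complex_def complex_eq_iff)

lemma dim_outcome_dist [simp]: "dim_vec (outcome_dist m M \<rho>) = m"
  by (simp add: outcome_dist_def)

lemma outcome_dist_prob:
  assumes "povm n m M" "\<rho> \<in> density_ops n"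
  shows "outcome_dist m M \<rho> \<in> prob_vecs m"
proof -
  have "(\<Sum>x<m. outcome_dist m M \<rho> $ x) = Re (\<Sum>x<m. mat_trace (M x * \<rho>))"
    by (simp add: outcome_dist_def)
  also have "\<dots> = 1"
    using povm_trace_sum[OF assms(1) density_opsD(2)[OF assms(2)]] density_opsD(4)[OF assms(2)] by simp
  finally show ?thesis
    using outcome_dist_nonneg(1)[OF assms] by (auto simp: prob_vecs_def intro: carrier_vecI)
qed

text \<open>The outcome is kept as a diagonal matrix because data processing is stated for maps
  between matrices.\<close>

definition measurement_channel :: "nat \<Rightarrow> (nat \<Rightarrow> complex mat) \<Rightarrow> complex mat \<Rightarrow> complex mat" where
  "measurement_channel m M X = mat_diag m (\<lambda>x. mat_trace (M x * X))"

lemma measurement_channel_density: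
  assumes "povm n m M" "\<rho> \<in> density_ops n"
  shows "measurement_channel m M \<rho> = diag_op (1\<^sub>m m) (outcome_dist m M \<rho>)"
  using diag_op_one[of "outcome_dist m M \<rho>"] outcome_dist_nonneg(2)[OF assms]
  by (auto simp: measurement_channel_def mat_diag_def intro!: eq_matI)

section \<open>Measurement channels are completely positive and trace preserving\<close>

lemma mat_trace_add:
  assumes "A \<in> carrier_mat n n" "B \<in> carrier_mat n n"
  shows "mat_trace (A + B) = mat_trace A + mat_trace B"
  using assms by (simp add: mat_trace_def sum.distrib)

lemma mat_trace_smult: "A \<in> carrier_mat n n \<Longrightarrow> mat_trace (c \<cdot>\<^sub>m A) = c * mat_trace A"
  by (simp add: mat_trace_def sum_distrib_left)

lemma linear_map_measurement_channel:
  assumes "povm n m M"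
  shows "linear_map n m (measurement_channel m M)"
  unfolding linear_map_def
proof (intro conjI ballI allI)
  note M = povmD(2)[OF assms]
  fix X :: "complex mat" assume X: "X \<in> carrier_mat n n"
  show "measurement_channel m M X \<in> carrier_mat m m" by (simp add: measurement_channel_def)
  show "measurement_channel m M (c \<cdot>\<^sub>m X) = c \<cdot>\<^sub>m measurement_channel m M X" for c
    using M X by (intro eq_matI)
      (auto simp: measurement_channel_def mat_diag_def mult_smult_distrib[of _ n n _ n] mat_trace_smult[of _ n])
  fix Y :: "complex mat" assume Y: "Y \<in> carrier_mat n n"
  show "measurement_channel m M (X + Y) = measurement_channel m M X + measurement_channel m M Y"
    using M X Y by (intro eq_matI)
      (auto simp: measurement_channel_def mat_diag_def mult_add_distrib_mat[of _ n n _ n] mat_trace_add[of _ n])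
qed

lemma sum_rotate:
  "(\<Sum>i\<in>A. \<Sum>j\<in>B. \<Sum>k\<in>C. f i j k) = (\<Sum>k\<in>C. \<Sum>i\<in>A. \<Sum>j\<in>B. f i j k)"
proof -
  have "(\<Sum>i\<in>A. \<Sum>j\<in>B. \<Sum>k\<in>C. f i j k) = (\<Sum>i\<in>A. \<Sum>k\<in>C. \<Sum>j\<in>B. f i j k)"
    by (intro sum.cong[OF refl] sum.swap)
  also have "\<dots> = (\<Sum>k\<in>C. \<Sum>i\<in>A. \<Sum>j\<in>B. f i j k)" by (rule sum.swap)
  finally show ?thesis .
qed

lemma block_index_less:
  fixes i k x m :: nat
  assumes "i < k" "x < m"
  shows "i * m + x < k * m"
proof -
  have "i * m + x < Suc i * m" using assms by simp
  also have "\<dots> \<le> k * m" using assms by (intro mult_le_mono1) simp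
  finally show ?thesis .
qed

text \<open>An index of the composite system is \<open>i * m + x\<close> with block \<open>i\<close>
  and position \<open>x\<close>, matching the layout in \<open>ampliation\<close>.\<close>

lemma sum_lessThan_times:
  fixes f :: "nat \<Rightarrow> 'a :: comm_monoid_add"
  shows "(\<Sum>r<k * m. f r) = (\<Sum>i<k. \<Sum>x<m. f (i * m + x))"
proof -
  have "(\<Sum>r<k * m. f r) = (\<Sum>i<k. sum f {i * m ..< i * m + m})"
    by (rule sum.nat_group[symmetric])
  also have "\<dots> = (\<Sum>i<k. \<Sum>x<m. f (i * m + x))"
    by (intro sum.cong[OF refl])
      (simp add: sum.atLeastLessThan_shift_0[of _ "_ * m"] atLeast0LessThan)
  finally show ?thesis .
qed

text \<open>
  Writing \<open>M\<^sub>x = S S\<^sup>*\<close>, the quadratic form of \<open>(id \<otimes> E)(X)\<close> becomes a sum of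
  values of the quadratic form of \<open>X\<close>, one for each outcome \<open>x\<close> and each column of \<open>S\<close>.
\<close>

lemma completely_positive_measurement_channel:
  assumes "povm n m M"
  shows "completely_positive n m (measurement_channel m M)"
  unfolding completely_positive_def
proof (intro allI impI)
  fix k X assume X: "psd (k * n) X"
  note M = povmD[OF assms]
  define B where "B i j = mat n n (\<lambda>(a, b). X $$ (i * n + a, j * n + b))" for i j
  have B: "B i j \<in> carrier_mat n n"
    "a < n \<Longrightarrow> b < n \<Longrightarrow> B i j $$ (a, b) = X $$ (i * n + a, j * n + b)" for i j a b
    by (simp_all add: B_def)
  let ?E = "measurement_channel m M"
  have entry: "ampliation k n m ?E X $$ (i * m + x, j * m + y) =
      (if x = y then mat_trace (M x * B i j) else 0)"
    if "i < k" "j < k" "x < m" "y < m" for i j x y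
  proof -
    have "i * m + x < k * m" "j * m + y < k * m"
      using that by (auto intro: block_index_less)
    then show ?thesis
      using that by (simp add: ampliation_def measurement_channel_def mat_diag_def B_def)
  qed
  \<comment> \<open>The output has no entries between different outcomes, so its quadratic form
    splits into one form per outcome \<open>x\<close>, and each can be treated alone.\<close>
  have outcome: "0 \<le> (\<Sum>i<k. \<Sum>j<k. cnj (g (i * m + x)) * mat_trace (M x * B i j) * g (j * m + x))"
    if x: "x < m" for x and g :: "nat \<Rightarrow> complex"
  proof -
    obtain U d where U: "U \<in> unitary_mats n" and d: "dim_vec d = n" "\<And>i. i < n \<Longrightarrow> 0 \<le> d $ i"
      and Mx: "M x = diag_op U d" using psd_spectral[OF M(1)[OF x]] by metis
    define S where "S = diag_op U (vec n (\<lambda>i. sqrt (d $ i)))"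
    note U' = unitary_matsD[OF U]
    have S: "S \<in> carrier_mat n n" using U' by (simp add: S_def)
    have "vec n (\<lambda>i. vec n (\<lambda>i. sqrt (d $ i)) $ i * vec n (\<lambda>i. sqrt (d $ i)) $ i) = d"
      using d by (intro eq_vecI) auto
    then have SS: "M x = S * mat_adjoint S"
      unfolding Mx S_def using U U' by (simp add: diag_op_adjoint diag_op_mult)
    have tr: "mat_trace (M x * B i j) =
        (\<Sum>c<n. \<Sum>b<n. \<Sum>a<n. cnj (S $$ (a, c)) * B i j $$ (a, b) * S $$ (b, c))" for i j
    proof -
      have "mat_trace (M x * B i j) = mat_trace (S * (mat_adjoint S * B i j))"
        using S B by (simp add: SS assoc_mult_mat[of _ n n _ n _ n])
      also have "\<dots> = mat_trace (mat_adjoint S * B i j * S)"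
        using S B by (intro mat_trace_mult_comm[of _ n n]) auto
      also have "\<dots> = (\<Sum>c<n. (mat_adjoint S * B i j * S) $$ (c, c))"
        using S by (simp add: mat_trace_def)
      also have "\<dots> = (\<Sum>c<n. \<Sum>b<n. \<Sum>a<n. cnj (S $$ (a, c)) * B i j $$ (a, b) * S $$ (b, c))"
        using S B by (intro sum.cong[OF refl] index_conj) auto
      finally show ?thesis .
    qed
    \<comment> \<open>The test vector for \<open>X\<close>: column \<open>c\<close> of
      \<open>S\<close> tensored with the slice of \<open>g\<close> at outcome \<open>x\<close>;
      \<open>div\<close> and \<open>mod\<close> decode the composite index.\<close>
    define h where "h c r = S $$ (r mod n, c) * g (r div n * m + x)" for c r
    have h: "h c (i * n + a) = S $$ (a, c) * g (i * m + x)" if "a < n" for c i a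
      using that by (simp add: h_def)
    have "(\<Sum>i<k. \<Sum>j<k. cnj (g (i * m + x)) * mat_trace (M x * B i j) * g (j * m + x)) =
        (\<Sum>i<k. \<Sum>j<k. \<Sum>c<n. \<Sum>b<n. \<Sum>a<n.
          cnj (h c (i * n + a)) * X $$ (i * n + a, j * n + b) * h c (j * n + b))"
      by (intro sum.cong[OF refl])
        (simp add: tr h B(2) sum_distrib_left sum_distrib_right mult_ac)
    also have "\<dots> = (\<Sum>c<n. \<Sum>i<k. \<Sum>j<k. \<Sum>b<n. \<Sum>a<n.
          cnj (h c (i * n + a)) * X $$ (i * n + a, j * n + b) * h c (j * n + b))"
      by (rule sum_rotate)
    also have "\<dots> = (\<Sum>c<n. \<Sum>i<k. \<Sum>a<n. \<Sum>j<k. \<Sum>b<n.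
          cnj (h c (i * n + a)) * X $$ (i * n + a, j * n + b) * h c (j * n + b))"
      by (intro sum.cong[OF refl] sum_rotate)
    also have "\<dots> = (\<Sum>c<n. \<Sum>r<k * n. \<Sum>s<k * n. cnj (h c r) * X $$ (r, s) * h c s)"
      by (simp add: sum_lessThan_times)
    also have "0 \<le> \<dots>"
      by (rule sum_nonneg) (use X in \<open>simp add: psd_iff_sum\<close>)
    finally show ?thesis .
  qed
  show "psd (k * m) (ampliation k n m ?E X)"
    unfolding psd_iff_sum
  proof (intro conjI allI)
    show "ampliation k n m ?E X \<in> carrier_mat (k * m) (k * m)" by (simp add: ampliation_def)
    fix g :: "nat \<Rightarrow> complex"
    have "(\<Sum>r<k * m. \<Sum>s<k * m. cnj (g r) * ampliation k n m ?E X $$ (r, s) * g s) =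
      (\<Sum>i<k. \<Sum>x<m. \<Sum>j<k. \<Sum>y<m. if x = y then
         cnj (g (i * m + x)) * mat_trace (M x * B i j) * g (j * m + x) else 0)"
      unfolding sum_lessThan_times by (intro sum.cong[OF refl]) (auto simp: entry)
    also have "\<dots> = (\<Sum>i<k. \<Sum>x<m. \<Sum>j<k. cnj (g (i * m + x)) * mat_trace (M x * B i j) * g (j * m + x))"
      by (intro sum.cong[OF refl]) simp
    also have "\<dots> = (\<Sum>x<m. \<Sum>i<k. \<Sum>j<k. cnj (g (i * m + x)) * mat_trace (M x * B i j) * g (j * m + x))"
      by (rule sum.swap)
    also have "0 \<le> \<dots>" by (rule sum_nonneg) (use outcome in simp)
    finally show "0 \<le> (\<Sum>r<k * m. \<Sum>s<k * m. cnj (g r) * ampliation k n m ?E X $$ (r, s) * g s)" .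
  qed
qed

lemma cptp_measurement_channel:
  assumes "povm n m M"
  shows "cptp n m (measurement_channel m M)"
  unfolding cptp_def
  using assms linear_map_measurement_channel completely_positive_measurement_channel povm_trace_sum
  by (auto simp: measurement_channel_def mat_trace_def[of "mat_diag _ _"]) (simp add: mat_diag_def)

text \<open>Data processing for the measurement channel: its outputs are diagonal in one basis,
  where the extension must agree with \<open>C\<close>. This is why the measured extension is the
  minimal one.\<close>

lemma classical_le_quantum_extension:
  assumes "quantum_extension C D" "povm n m M" "\<rho> \<in> density_ops n" "\<sigma> \<in> density_ops n"
  shows "C (outcome_dist m M \<rho>) (outcome_dist m M \<sigma>) \<le> D \<rho> \<sigma>"
proof -
  have "D (measurement_channel m M \<rho>) (measurement_channel m M \<sigma>) \<le> D \<rho> \<sigma>"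
    using assms cptp_measurement_channel unfolding quantum_extension_def quantum_divergence_def by blast
  moreover have "D (measurement_channel m M \<rho>) (measurement_channel m M \<sigma>) =
      C (outcome_dist m M \<rho>) (outcome_dist m M \<sigma>)"
    unfolding measurement_channel_density[OF assms(2,3)] measurement_channel_density[OF assms(2,4)]
    using assms one_unitary outcome_dist_prob[OF assms(2)] unfolding quantum_extension_def by blast
  ultimately show ?thesis by simp
qed

text \<open>The contraction \<open>measured_l1_le_trace_norm\<close> applies to the difference of
  two states, since it asks only for a Hermitian argument.\<close>

lemma outcome_dist_l1_le:
  assumes "povm n m M" "\<rho> \<in> density_ops n" "\<rho>' \<in> density_ops n"
  shows "(\<Sum>x<m. \<bar>outcome_dist m M \<rho> $ x - outcome_dist m M \<rho>' $ x\<bar>) \<le> trace_norm (\<rho> - \<rho>')"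
proof -
  note \<rho> = density_opsD[OF assms(2)] and \<rho>' = density_opsD[OF assms(3)]
  have X: "\<rho> - \<rho>' \<in> carrier_mat n n" using \<rho>(2) \<rho>'(2) by auto
  have "cnj (\<rho> $$ (j, i)) = \<rho> $$ (i, j)" "cnj (\<rho>' $$ (j, i)) = \<rho>' $$ (i, j)" if "i < n" "j < n" for i j
    using arg_cong[OF \<rho>(3), of "\<lambda>A. A $$ (i, j)"] arg_cong[OF \<rho>'(3), of "\<lambda>A. A $$ (i, j)"] that \<rho>(2) \<rho>'(2)
    by auto
  then have herm: "mat_adjoint (\<rho> - \<rho>') = \<rho> - \<rho>'"
    using \<rho>(2) \<rho>'(2) by (intro eq_matI) auto
  have "mat_trace (M x * (\<rho> - \<rho>')) = mat_trace (M x * \<rho>) - mat_trace (M x * \<rho>')" if "x < m" for x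
    using povmD(2)[OF assms(1) that] \<rho>(2) \<rho>'(2)
    by (simp add: mult_minus_distrib_mat[of _ n n _ n])
      (simp add: mat_trace_def sum_subtractf)
  then show ?thesis
    using measured_l1_le_trace_norm[OF assms(1) X herm] by (simp add: outcome_dist_def)
qed

section \<open>Smoothing of classical distributions\<close>

text \<open>Apply ln t \<le> t - 1 to x / w and y / w, where \<open>w\<close> is the weighted
  arithmetic mean; the weighted average of the right-hand sides is then 0.\<close>

lemma powr_weighted_amgm:
  fixes x y \<theta> :: real
  assumes "0 < x" "0 < y" "0 < \<theta>" "\<theta> < 1"
  shows "x powr \<theta> * y powr (1 - \<theta>) \<le> \<theta> * x + (1 - \<theta>) * y"
proof -
  define w where "w = \<theta> * x + (1 - \<theta>) * y"
  have w: "0 < w" using assms by (simp add: w_def add_pos_pos)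
  have "ln x - ln w \<le> x / w - 1" "ln y - ln w \<le> y / w - 1"
    using ln_le_minus_one[of "x / w"] ln_le_minus_one[of "y / w"] assms w by (simp_all add: ln_div)
  then have "\<theta> * (ln x - ln w) + (1 - \<theta>) * (ln y - ln w) \<le> \<theta> * (x / w - 1) + (1 - \<theta>) * (y / w - 1)"
    using assms by (intro add_mono mult_left_mono) auto
  also have "\<dots> = (\<theta> * x + (1 - \<theta>) * y) / w - 1" using w by (simp add: field_simps)
  also have "\<dots> = 0" using w by (simp flip: w_def)
  finally have "\<theta> * ln x + (1 - \<theta>) * ln y \<le> ln w" by (simp add: algebra_simps)
  then have "exp (\<theta> * ln x + (1 - \<theta>) * ln y) \<le> w" using w by (simp add: ln_ge_iff)
  then show ?thesis using assms by (simp add: powr_def exp_add w_def)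
qed

text \<open>Hoelder's inequality: \<open>m\<close> is a geometric mean of the summands
  \<open>u\<close> and \<open>v\<close> of orders \<open>a\<close> and \<open>b\<close>. Normalising
  both to total mass 1 allows weighted AM-GM term by term.\<close>

lemma renyi_sum_interpolation:
  fixes m q :: "'a \<Rightarrow> real" and a b :: real
  assumes "finite T" "T \<noteq> {}" "\<And>x. x \<in> T \<Longrightarrow> 0 < m x" "\<And>x. x \<in> T \<Longrightarrow> 0 < q x" "a < 1" "1 < b"
  shows "(b - a) * ln (\<Sum>x\<in>T. m x) \<le>
    (b - 1) * ln (\<Sum>x\<in>T. m x powr a * q x powr (1 - a)) +
    (1 - a) * ln (\<Sum>x\<in>T. m x powr b * q x powr (1 - b))"
proof -
  define u where "u x = m x powr a * q x powr (1 - a)" for x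
  define v where "v x = m x powr b * q x powr (1 - b)" for x
  define A where "A = sum u T"
  define B where "B = sum v T"
  \<comment> \<open>The weight that writes 1 as the convex combination of \<open>a\<close> and
    \<open>b\<close>; the exponents of \<open>m\<close> then add up to 1 and those of
    \<open>q\<close> to 0.\<close>
  define \<theta> where "\<theta> = (b - 1) / (b - a)"
  have uv: "0 < u x" "0 < v x" if "x \<in> T" for x
    using assms(3,4)[OF that] by (simp_all add: u_def v_def)
  have AB: "0 < A" "0 < B" unfolding A_def B_def using assms(1,2) uv by (auto intro: sum_pos)
  have \<theta>: "0 < \<theta>" "\<theta> < 1" "\<theta> * (b - a) = b - 1" "(1 - \<theta>) * (b - a) = 1 - a"
    using assms by (auto simp: \<theta>_def field_simps)
  have "a * \<theta> + b * (1 - \<theta>) = b - \<theta> * (b - a)" by (simp add: algebra_simps)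
  then have e: "a * \<theta> + b * (1 - \<theta>) = 1" "(1 - a) * \<theta> + (1 - b) * (1 - \<theta>) = 0"
    using \<theta>(3) by (simp_all add: algebra_simps)
  have m_eq: "m x = u x powr \<theta> * v x powr (1 - \<theta>)" if "x \<in> T" for x
  proof -
    note pos = assms(3,4)[OF that]
    have "u x powr \<theta> * v x powr (1 - \<theta>) =
      m x powr (a * \<theta> + b * (1 - \<theta>)) * q x powr ((1 - a) * \<theta> + (1 - b) * (1 - \<theta>))"
      using pos unfolding u_def v_def by (simp add: powr_mult powr_powr powr_add)
    then show ?thesis using pos e by simp
  qed
  have "(\<Sum>x\<in>T. m x) / (A powr \<theta> * B powr (1 - \<theta>)) =
      (\<Sum>x\<in>T. (u x / A) powr \<theta> * (v x / B) powr (1 - \<theta>))"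
    unfolding sum_divide_distrib using uv AB
    by (intro sum.cong[OF refl]) (simp add: m_eq powr_divide less_imp_le)
  also have "\<dots> \<le> (\<Sum>x\<in>T. \<theta> * (u x / A) + (1 - \<theta>) * (v x / B))"
    using uv AB \<theta> by (intro sum_mono powr_weighted_amgm) auto
  also have "\<dots> = \<theta> * (A / A) + (1 - \<theta>) * (B / B)"
    by (simp add: sum.distrib A_def B_def flip: sum_distrib_left sum_divide_distrib)
  also have "\<dots> = 1" using AB by simp
  finally have "(\<Sum>x\<in>T. m x) \<le> A powr \<theta> * B powr (1 - \<theta>)"
    using AB by (simp add: divide_le_eq)
  then have "ln (\<Sum>x\<in>T. m x) \<le> ln (A powr \<theta> * B powr (1 - \<theta>))"
    using assms AB by (subst ln_le_cancel_iff) (auto intro: sum_pos)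
  also have "\<dots> = \<theta> * ln A + (1 - \<theta>) * ln B"
    using AB by (simp add: ln_mult ln_powr)
  finally have "(b - a) * ln (\<Sum>x\<in>T. m x) \<le> (b - a) * (\<theta> * ln A + (1 - \<theta>) * ln B)"
    using assms by (intro mult_left_mono) auto
  also have "\<dots> = (\<theta> * (b - a)) * ln A + ((1 - \<theta>) * (b - a)) * ln B"
    by (simp add: algebra_simps)
  finally show ?thesis unfolding \<theta>(3,4) by (simp add: A_def B_def u_def v_def)
qed

section \<open>Renyi divergences by range of the order, and the common mass\<close>

lemma prob_vecsD:
  assumes "p \<in> prob_vecs d"
  shows "dim_vec p = d" "\<And>x. x < d \<Longrightarrow> 0 \<le> p $ x" "(\<Sum>x<d. p $ x) = 1"
  using assms by (auto simp: prob_vecs_def)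

lemma vec_supp_prob: "p \<in> prob_vecs d \<Longrightarrow> vec_supp p = {x. x < d \<and> 0 < p $ x}"
  by (simp add: vec_supp_def prob_vecsD)

lemma finite_vec_supp [simp]: "finite (vec_supp p)"
  by (simp add: vec_supp_def)

text \<open>On the support of \<open>p\<close> the power of order 0 is 1, so the clause for order 0
  agrees with the general formula and needs no separate treatment later.\<close>

lemma renyi_div_less_one:
  assumes "0 \<le> a" "a < 1" "q \<in> prob_vecs d" "dim_vec p = d" "vec_supp p \<inter> vec_supp q \<noteq> {}"
  shows "renyi_div (ereal a) p q =
    ereal (1 / (a - 1) * log 2 (\<Sum>x\<in>vec_supp p. (p $ x) powr a * (q $ x) powr (1 - a)))"
proof (cases "a = 0")
  case True
  have "(\<Sum>x\<in>vec_supp p. (p $ x) powr 0 * (q $ x) powr (1 - 0)) = (\<Sum>x\<in>vec_supp p. q $ x)"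
    using assms prob_vecsD(2)[OF assms(3)] by (intro sum.cong[OF refl]) (auto simp: vec_supp_def)
  then show ?thesis using True assms by (simp add: renyi_div_def zero_ereal_def[symmetric])
qed (use assms in \<open>auto simp: renyi_div_def Let_def one_ereal_def\<close>)

lemma renyi_div_greater_one:
  assumes "1 < b" "vec_supp p \<subseteq> vec_supp q"
  shows "renyi_div (ereal b) p q =
    ereal (1 / (b - 1) * log 2 (\<Sum>x\<in>vec_supp p. (p $ x) powr b * (q $ x) powr (1 - b)))"
  using assms by (auto simp: renyi_div_def Let_def one_ereal_def)

lemma renyi_div_infinity:
  assumes "vec_supp p \<subseteq> vec_supp q"
  shows "renyi_div \<infinity> p q = ereal (log 2 (Max ((\<lambda>x. p $ x / q $ x) ` vec_supp p)))"
  using assms by (auto simp: renyi_div_def)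

text \<open>Uses 2 min(s, t) = s + t - |s - t|; entries outside either support contribute 0 to the
  minimum.\<close>

lemma min_mass_ge:
  assumes "p \<in> prob_vecs d" "p' \<in> prob_vecs d" "(\<Sum>x<d. \<bar>p $ x - p' $ x\<bar>) \<le> 2 * \<epsilon>"
  shows "1 - \<epsilon> \<le> (\<Sum>x\<in>vec_supp p \<inter> vec_supp p'. min (p $ x) (p' $ x))"
proof -
  have "2 * (\<Sum>x<d. min (p $ x) (p' $ x)) = (\<Sum>x<d. p $ x + p' $ x - \<bar>p $ x - p' $ x\<bar>)"
    unfolding sum_distrib_left by (intro sum.cong[OF refl]) (auto simp: min_def)
  also have "\<dots> \<ge> 2 - 2 * \<epsilon>"
    using assms by (simp add: sum_subtractf sum.distrib prob_vecsD)
  finally have "1 - \<epsilon> \<le> (\<Sum>x<d. min (p $ x) (p' $ x))" by simp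
  also have "\<dots> = (\<Sum>x\<in>vec_supp p \<inter> vec_supp p'. min (p $ x) (p' $ x))"
  proof (rule sum.mono_neutral_right; (intro ballI)?)
    fix x assume "x \<in> {..<d} - vec_supp p \<inter> vec_supp p'"
    then show "min (p $ x) (p' $ x) = 0"
      using prob_vecsD(2)[OF assms(1), of x] prob_vecsD(2)[OF assms(2), of x]
      by (auto simp: vec_supp_prob[OF assms(1)] vec_supp_prob[OF assms(2)] min_def)
  qed (auto simp: vec_supp_prob[OF assms(1)])
  finally show ?thesis .
qed

text \<open>The situation after a measurement. If \<open>supp\<close> fails, the divergence of
  \<open>p'\<close> from \<open>q\<close> at an order above 1 is infinite and the desired bound is
  immediate.\<close>

locale close_prob_vecs =
  fixes p p' q :: "real vec" and d :: nat and \<epsilon> a :: real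
  assumes p: "p \<in> prob_vecs d" and p': "p' \<in> prob_vecs d" and q: "q \<in> prob_vecs d"
    and close: "(\<Sum>x<d. \<bar>p $ x - p' $ x\<bar>) \<le> 2 * \<epsilon>" and \<epsilon>: "\<epsilon> < 1"
    and a: "0 \<le> a" "a < 1" and supp: "vec_supp p' \<subseteq> vec_supp q"
begin

abbreviation "T \<equiv> vec_supp p \<inter> vec_supp p'"

definition m :: "nat \<Rightarrow> real" where "m x = min (p $ x) (p' $ x)"

lemma sum_m: "1 - \<epsilon> \<le> sum m T"
  using min_mass_ge[OF p p' close] by (simp add: m_def)

lemma T_pos: "x \<in> T \<Longrightarrow> 0 < m x" "x \<in> T \<Longrightarrow> 0 < q $ x"
  using supp by (auto simp: m_def vec_supp_def)

lemma T_term_pos: "x \<in> T \<Longrightarrow> 0 < m x powr s * (q $ x) powr t"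
  using T_pos(1)[of x] T_pos(2)[of x] by simp

text \<open>The common mass is at least 1 - \<epsilon> > 0. Hence \<open>p\<close> and
  \<open>q\<close> overlap, and the sums over \<open>T\<close> are positive, as their logarithms
  require.\<close>

lemma finite_T: "finite T" and T_nonempty: "T \<noteq> {}"
proof -
  show "T \<noteq> {}"
  proof
    assume T: "T = {}"
    show False using sum_m \<epsilon> unfolding T by simp
  qed
qed simp

lemma renyi_a:
  "renyi_div (ereal a) p q =
    ereal (1 / (a - 1) * log 2 (\<Sum>x\<in>vec_supp p. (p $ x) powr a * (q $ x) powr (1 - a)))"
  using a q p T_nonempty supp by (intro renyi_div_less_one) (auto simp: prob_vecsD)

lemma sum_a_mono:
  "(\<Sum>x\<in>T. m x powr a * (q $ x) powr (1 - a)) \<le>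
   (\<Sum>x\<in>vec_supp p. (p $ x) powr a * (q $ x) powr (1 - a))"
proof -
  have "(\<Sum>x\<in>T. m x powr a * (q $ x) powr (1 - a)) \<le> (\<Sum>x\<in>T. (p $ x) powr a * (q $ x) powr (1 - a))"
    using a T_pos(1) by (intro sum_mono mult_right_mono powr_mono2) (auto simp: m_def less_imp_le)
  also have "\<dots> \<le> (\<Sum>x\<in>vec_supp p. (p $ x) powr a * (q $ x) powr (1 - a))"
    by (intro sum_mono2) auto
  finally show ?thesis .
qed

text \<open>Interpolation bounds the mass of \<open>m\<close> by its sums of orders \<open>a\<close>
  and \<open>b\<close>; these only grow when \<open>m\<close> is replaced by \<open>p\<close> and
  \<open>p'\<close> respectively, because both exponents are nonnegative.\<close>

lemma renyi_div_le_finite: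
  assumes b: "1 < b"
  shows "renyi_div (ereal a) p q \<le>
    renyi_div (ereal b) p' q + ereal ((1 / (b - 1) + 1 / (1 - a)) * log 2 (1 / (1 - \<epsilon>)))"
proof -
  define A where "A = (\<Sum>x\<in>vec_supp p. (p $ x) powr a * (q $ x) powr (1 - a))"
  define B where "B = (\<Sum>x\<in>vec_supp p'. (p' $ x) powr b * (q $ x) powr (1 - b))"
  let ?A = "\<Sum>x\<in>T. m x powr a * (q $ x) powr (1 - a)"
  let ?B = "\<Sum>x\<in>T. m x powr b * (q $ x) powr (1 - b)"
  have "?B \<le> (\<Sum>x\<in>T. (p' $ x) powr b * (q $ x) powr (1 - b))"
    using b T_pos(1) by (intro sum_mono mult_right_mono powr_mono2) (auto simp: m_def less_imp_le)
  also have "\<dots> \<le> B" unfolding B_def by (intro sum_mono2) auto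
  finally have B: "?B \<le> B" .
  have pos: "0 < ?A" "0 < ?B" using finite_T T_nonempty by (auto intro!: sum_pos T_term_pos)
  have "(b - a) * ln (1 - \<epsilon>) \<le> (b - a) * ln (sum m T)"
    using \<epsilon> a b sum_m by (intro mult_left_mono) auto
  also have "\<dots> \<le> (b - 1) * ln ?A + (1 - a) * ln ?B"
    using finite_T T_nonempty T_pos a b by (intro renyi_sum_interpolation) auto
  also have "\<dots> \<le> (b - 1) * ln A + (1 - a) * ln B"
    using pos B sum_a_mono a b by (intro add_mono mult_left_mono) (auto simp: A_def)
  finally have "(b - a) * log 2 (1 - \<epsilon>) \<le> (b - 1) * log 2 A + (1 - a) * log 2 B"
    by (simp add: log_def divide_right_mono flip: add_divide_distrib)
  \<comment> \<open>Since b - a = (b - 1) + (1 - a), this division produces the two fractions of the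
    constant.\<close>
  then have "((b - a) * log 2 (1 - \<epsilon>)) / ((b - 1) * (1 - a)) \<le>
      ((b - 1) * log 2 A + (1 - a) * log 2 B) / ((b - 1) * (1 - a))"
    using a b by (intro divide_right_mono) auto
  moreover have "((b - 1) * X + (1 - a) * Y) / ((b - 1) * (1 - a)) = X / (1 - a) + Y / (b - 1)" for X Y
    using a b by (simp add: field_simps)
  moreover have "((b - a) * Z) / ((b - 1) * (1 - a)) = (1 / (b - 1) + 1 / (1 - a)) * Z" for Z
    using a b by (simp add: field_simps)
  ultimately have "(1 / (b - 1) + 1 / (1 - a)) * log 2 (1 - \<epsilon>) \<le> log 2 A / (1 - a) + log 2 B / (b - 1)"
    by simp
  moreover have "log 2 (1 / (1 - \<epsilon>)) = - log 2 (1 - \<epsilon>)" using \<epsilon> by (simp add: log_divide)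
  moreover have "1 / (a - 1) * X = - (X / (1 - a))" for X using a by (simp add: field_simps)
  ultimately show ?thesis
    unfolding renyi_a renyi_div_greater_one[OF b supp] A_def[symmetric] B_def[symmetric] by simp
qed

text \<open>Here the order-\<open>b\<close> sum is replaced by the pointwise bound m \<le> L q on
  \<open>T\<close>, applied to the factor m^(1 - a) of m = m^a m^(1 - a).\<close>

lemma renyi_div_le_infinity:
  "renyi_div (ereal a) p q \<le> renyi_div \<infinity> p' q + ereal (1 / (1 - a) * log 2 (1 / (1 - \<epsilon>)))"
proof -
  define A where "A = (\<Sum>x\<in>vec_supp p. (p $ x) powr a * (q $ x) powr (1 - a))"
  define L where "L = Max ((\<lambda>x. p' $ x / q $ x) ` vec_supp p')"
  let ?A = "\<Sum>x\<in>T. m x powr a * (q $ x) powr (1 - a)"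
  have mL: "m x \<le> L * q $ x" if "x \<in> T" for x
  proof -
    have "p' $ x / q $ x \<le> L" unfolding L_def using that by (intro Max_ge) auto
    then show ?thesis using T_pos(2)[OF that] by (simp add: m_def divide_le_eq min.coboundedI2)
  qed
  have L: "0 < L"
  proof -
    obtain x where x: "x \<in> T" using T_nonempty by blast
    have "0 < L * q $ x" using T_pos(1)[OF x] mL[OF x] by simp
    then show ?thesis using T_pos(2)[OF x] by (simp add: zero_less_mult_iff)
  qed
  have pos: "0 < ?A" using finite_T T_nonempty by (auto intro!: sum_pos T_term_pos)
  have "1 - \<epsilon> \<le> sum m T" by (rule sum_m)
  also have "\<dots> \<le> (\<Sum>x\<in>T. L powr (1 - a) * (m x powr a * (q $ x) powr (1 - a)))"
  proof (rule sum_mono)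
    fix x assume x: "x \<in> T"
    have "m x = m x powr a * m x powr (1 - a)" using T_pos(1)[OF x] by (simp flip: powr_add)
    also have "\<dots> \<le> m x powr a * (L * q $ x) powr (1 - a)"
      using T_pos(1)[OF x] mL[OF x] a by (intro mult_left_mono powr_mono2) auto
    also have "\<dots> = L powr (1 - a) * (m x powr a * (q $ x) powr (1 - a))"
      using L T_pos(2)[OF x] by (simp add: powr_mult)
    finally show "m x \<le> L powr (1 - a) * (m x powr a * (q $ x) powr (1 - a))" .
  qed
  also have "\<dots> = L powr (1 - a) * ?A" by (simp add: sum_distrib_left)
  also have "\<dots> \<le> L powr (1 - a) * A" unfolding A_def by (intro mult_left_mono sum_a_mono) auto
  finally have "log 2 (1 - \<epsilon>) \<le> log 2 (L powr (1 - a) * A)"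
    using \<epsilon> by (intro log_mono) auto
  also have "\<dots> = (1 - a) * log 2 L + log 2 A"
    using L pos sum_a_mono by (subst log_mult_pos) (auto simp: A_def log_powr)
  finally have "log 2 (1 - \<epsilon>) / (1 - a) \<le> ((1 - a) * log 2 L + log 2 A) / (1 - a)"
    using a by (intro divide_right_mono) auto
  also have "\<dots> = log 2 L + log 2 A / (1 - a)" using a by (simp add: field_simps)
  finally have "log 2 (1 - \<epsilon>) / (1 - a) \<le> log 2 L + log 2 A / (1 - a)" .
  moreover have "log 2 (1 / (1 - \<epsilon>)) = - log 2 (1 - \<epsilon>)" using \<epsilon> by (simp add: log_divide)
  moreover have "1 / (a - 1) * X = - (X / (1 - a))" for X using a by (simp add: field_simps)
  ultimately show ?thesis
    unfolding renyi_a renyi_div_infinity[OF supp] A_def[symmetric] L_def[symmetric] by simp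
qed

end

text \<open>In \<open>ereal\<close> arithmetic 1 / \<infinity> = 0, so \<beta> = \<infinity> is
  covered by the same formula.\<close>

definition optimal_constant :: "real \<Rightarrow> ereal \<Rightarrow> ereal \<Rightarrow> ereal" where
  "optimal_constant \<epsilon> \<alpha> \<beta> = (1 / (\<beta> - 1) + 1 / (1 - \<alpha>)) * ereal (log 2 (1 / (1 - \<epsilon>)))"

lemma optimal_constant_finite:
  assumes "a < 1" "1 < b"
  shows "optimal_constant \<epsilon> (ereal a) (ereal b) =
    ereal ((1 / (b - 1) + 1 / (1 - a)) * log 2 (1 / (1 - \<epsilon>)))"
  using assms by (simp add: optimal_constant_def one_ereal_def)

lemma optimal_constant_infinity:
  assumes "a < 1"
  shows "optimal_constant \<epsilon> (ereal a) \<infinity> = ereal (1 / (1 - a) * log 2 (1 / (1 - \<epsilon>)))"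
  using assms by (simp add: optimal_constant_def one_ereal_def)

lemma renyi_div_smoothing:
  assumes "p \<in> prob_vecs d" "p' \<in> prob_vecs d" "q \<in> prob_vecs d"
    and "(\<Sum>x<d. \<bar>p $ x - p' $ x\<bar>) \<le> 2 * \<epsilon>" "\<epsilon> < 1" "0 \<le> \<alpha>" "\<alpha> < 1" "1 < \<beta>"
  shows "renyi_div \<alpha> p q \<le> renyi_div \<beta> p' q + optimal_constant \<epsilon> \<alpha> \<beta>"
proof -
  obtain a where \<alpha>_eq: "\<alpha> = ereal a" "0 \<le> a" "a < 1" using assms by (cases \<alpha>) auto
  show ?thesis
  proof (cases "vec_supp p' \<subseteq> vec_supp q")
    case True
    interpret close_prob_vecs p p' q d \<epsilon> a
      using assms \<alpha>_eq True by unfold_locales auto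
    show ?thesis
      using assms(8) \<alpha>_eq renyi_div_le_finite renyi_div_le_infinity
      by (cases \<beta>) (auto simp: optimal_constant_finite optimal_constant_infinity)
  next
    case False
    then have "renyi_div \<beta> p' q = \<infinity>"
      using less_imp_le[OF assms(8)] by (auto simp: renyi_div_def)
    moreover have "optimal_constant \<epsilon> \<alpha> \<beta> \<noteq> -\<infinity>"
      using assms(8) \<alpha>_eq by (cases \<beta>) (auto simp: optimal_constant_finite optimal_constant_infinity)
    ultimately show ?thesis by simp
  qed
qed

section \<open>Upper bound on \<open>nu\<close>\<close>

lemma smoothing_ballD:
  assumes "\<rho> \<in> density_ops n" "\<rho>' \<in> smoothing_ball \<epsilon> \<rho>"
  shows "\<rho>' \<in> density_ops n" "trace_norm (\<rho> - \<rho>') \<le> 2 * \<epsilon>"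
  using assms by (auto simp: smoothing_ball_def density_opsD)

text \<open>Fix a smoothed state and a measurement, and apply the classical bound to the outcomes.
  The supremum over measurements and the infimum over smoothed states are taken afterwards.\<close>

lemma nu_le_optimal_constant:
  assumes "\<epsilon> < 1" "0 \<le> \<alpha>" "\<alpha> < 1" "1 < \<beta>" and D: "quantum_extension (renyi_div \<beta>) D"
  shows "nu \<epsilon> \<alpha> D \<le> optimal_constant \<epsilon> \<alpha> \<beta>"
proof -
  obtain a where a: "\<alpha> = ereal a" "a < 1" using assms by (cases \<alpha>) auto
  \<comment> \<open>A real constant is what \<open>nu_le_iff\<close> requires and lets it be moved
    across the inequality.\<close>
  obtain r where r: "optimal_constant \<epsilon> \<alpha> \<beta> = ereal r"
    using assms(4) a by (cases \<beta>) (auto simp: optimal_constant_finite optimal_constant_infinity)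
  have "measured_div (renyi_div \<alpha>) \<rho> \<sigma> - ereal r \<le> D \<rho>' \<sigma>"
    if \<rho>: "\<rho> \<in> density_ops n" and \<sigma>: "\<sigma> \<in> density_ops n" and \<rho>': "\<rho>' \<in> smoothing_ball \<epsilon> \<rho>" for n \<rho> \<sigma> \<rho>'
  proof -
    note ball = smoothing_ballD[OF \<rho> \<rho>']
    have "measured_div (renyi_div \<alpha>) \<rho> \<sigma> \<le> D \<rho>' \<sigma> + ereal r"
      unfolding measured_div_def
    proof (rule SUP_least, clarify)
      fix m M assume "povm (dim_row \<rho>) m M"
      then have M: "povm n m M" using density_opsD[OF \<rho>] by simp
      have "(\<Sum>x<m. \<bar>outcome_dist m M \<rho> $ x - outcome_dist m M \<rho>' $ x\<bar>) \<le> 2 * \<epsilon>"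
        using outcome_dist_l1_le[OF M \<rho> ball(1)] ball(2) by simp
      then have "renyi_div \<alpha> (outcome_dist m M \<rho>) (outcome_dist m M \<sigma>) \<le>
          renyi_div \<beta> (outcome_dist m M \<rho>') (outcome_dist m M \<sigma>) + ereal r"
        unfolding r[symmetric] using assms outcome_dist_prob[OF M] \<rho> \<sigma> ball(1)
        by (intro renyi_div_smoothing) auto
      also have "\<dots> \<le> D \<rho>' \<sigma> + ereal r"
        using classical_le_quantum_extension[OF D M ball(1) \<sigma>] by (rule add_right_mono)
      finally show "renyi_div \<alpha> (outcome_dist m M \<rho>) (outcome_dist m M \<sigma>) \<le> D \<rho>' \<sigma> + ereal r" .
    qed
    then show ?thesis by (simp add: ereal_minus_le)
  qed
  then show ?thesis
    unfolding r nu_le_iff smoothed_div_def by (blast intro: INF_greatest)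
qed

section \<open>Lower bounds\<close>

lemma diag_density_ops:
  assumes "p \<in> prob_vecs d"
  shows "diag_op (1\<^sub>m d) p \<in> density_ops d"
  using psd_diag_op[of "1\<^sub>m d" d p] mat_trace_diag_op[OF one_unitary, of p d] prob_vecsD[OF assms]
  by (simp add: density_ops_def)

lemma diag_op_one_diff:
  assumes "dim_vec p = d" "dim_vec p' = d"
  shows "diag_op (1\<^sub>m d) p - diag_op (1\<^sub>m d) p' = diag_op (1\<^sub>m d) (p - p')"
  using assms diag_op_one[of p] diag_op_one[of p'] diag_op_one[of "p - p'"]
  by (auto simp: mat_diag_def intro!: eq_matI)

definition basis_povm :: "nat \<Rightarrow> nat \<Rightarrow> complex mat" where
  "basis_povm d x = mat_diag d (\<lambda>i. if i = x then 1 else 0)"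

lemma povm_basis: "povm d d (basis_povm d)"
proof -
  have "psd d (basis_povm d x)" for x
    unfolding basis_povm_def by (rule psd_mat_diag) (simp add: less_eq_complex_def)
  then show ?thesis
    by (auto simp: povm_def basis_povm_def mat_diag_def intro!: eq_matI)
qed

lemma outcome_dist_basis:
  assumes "p \<in> carrier_vec d"
  shows "outcome_dist d (basis_povm d) (diag_op (1\<^sub>m d) p) = p"
proof (rule eq_vecI)
  fix x assume x: "x < dim_vec p"
  have "mat_trace (basis_povm d x * diag_op (1\<^sub>m d) p) =
      (\<Sum>i<d. (if i = x then 1 else 0) * complex_of_real (p $ i))"
    using assms
    by (subst mat_trace_mult_diag_op[of _ d]) (auto simp: basis_povm_def mat_diag_def intro!: sum.cong)
  also have "\<dots> = complex_of_real (p $ x)"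
    using x assms by (simp add: if_distribR if_distrib[of "\<lambda>x. x * _"] cong: if_cong)
  finally show "outcome_dist d (basis_povm d) (diag_op (1\<^sub>m d) p) $ x = p $ x"
    using x assms by (simp add: outcome_dist_def)
qed (use assms in simp)

lemma nu_ge_classical:
  assumes D: "quantum_extension (renyi_div \<beta>) D"
    and p: "p \<in> prob_vecs d" and p': "p' \<in> prob_vecs d" and q: "q \<in> prob_vecs d"
    and close: "(\<Sum>x<d. \<bar>p $ x - p' $ x\<bar>) \<le> 2 * \<epsilon>" and y: "renyi_div \<beta> p' q = ereal y"
  shows "renyi_div \<alpha> p q - ereal y \<le> nu \<epsilon> \<alpha> D"
proof -
  let ?d = "diag_op (1\<^sub>m d)"
  note dens = diag_density_ops[OF p] diag_density_ops[OF p'] diag_density_ops[OF q]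
  have "renyi_div \<alpha> (outcome_dist d (basis_povm d) (?d p)) (outcome_dist d (basis_povm d) (?d q))
      \<le> measured_div (renyi_div \<alpha>) (?d p) (?d q)"
    unfolding measured_div_def using povm_basis[of d] density_opsD(5)[OF dens(1)]
    by (intro SUP_upper2[of "(d, basis_povm d)"]) auto
  then have measured: "renyi_div \<alpha> p q \<le> measured_div (renyi_div \<alpha>) (?d p) (?d q)"
    using p q by (simp add: outcome_dist_basis prob_vecs_def)
  have "trace_norm (?d p - ?d p') = (\<Sum>x<d. \<bar>p $ x - p' $ x\<bar>)"
    using prob_vecsD(1)[OF p] prob_vecsD(1)[OF p']
    by (simp add: diag_op_one_diff trace_norm_diag_op[OF one_unitary])
  then have "?d p' \<in> smoothing_ball \<epsilon> (?d p)"
    using dens density_opsD(5)[OF dens(1)] close by (simp add: smoothing_ball_def)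
  then have "smoothed_div \<epsilon> D (?d p) (?d q) \<le> D (?d p') (?d q)"
    unfolding smoothed_div_def by (rule INF_lower)
  also have "\<dots> = ereal y"
    using D one_unitary p' q y unfolding quantum_extension_def by metis
  finally have smoothed: "smoothed_div \<epsilon> D (?d p) (?d q) \<le> ereal y" .
  have "renyi_div \<alpha> p q - ereal y \<le>
      measured_div (renyi_div \<alpha>) (?d p) (?d q) - smoothed_div \<epsilon> D (?d p) (?d q)"
    using measured smoothed by (rule ereal_minus_mono)
  also have "\<dots> \<le> nu \<epsilon> \<alpha> D"
    unfolding nu_def using dens smoothed
    by (intro SUP_upper2[of "(?d p, ?d q)"]) auto
  finally show ?thesis .
qed

text \<open>The parameter \<delta> stays free because each range of orders calls for its own choice:
  a fixed value, values tending to 0, or one tuned to a prescribed error.\<close>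

locale extremal_triple =
  fixes \<epsilon> \<delta> :: real
  assumes \<epsilon>: "0 < \<epsilon>" "\<epsilon> < 1" and \<delta>: "0 < \<delta>" "\<delta> < 1"
begin

definition p :: "real vec" where "p = vec_of_list [1 - \<epsilon>, 0, \<epsilon>]"
definition p' :: "real vec" where "p' = vec_of_list [1 - \<epsilon>, \<epsilon>, 0]"
definition q :: "real vec" where "q = vec_of_list [\<delta>, 1 - \<delta>, 0]"

lemma index [simp]:
  "p $ 0 = 1 - \<epsilon>" "p $ Suc 0 = 0" "p $ 2 = \<epsilon>"
  "p' $ 0 = 1 - \<epsilon>" "p' $ Suc 0 = \<epsilon>" "p' $ 2 = 0"
  "q $ 0 = \<delta>" "q $ Suc 0 = 1 - \<delta>" "q $ 2 = 0"
  "dim_vec p = 3" "dim_vec p' = 3" "dim_vec q = 3"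
  by (simp_all add: p_def p'_def q_def vec_of_list_index numeral_2_eq_2)

lemma lessThan_3: "{..<3} = {0, Suc 0, 2 :: nat}"
  by auto

lemma less_3: "x < 3 \<longleftrightarrow> x = 0 \<or> x = Suc 0 \<or> x = (2 :: nat)"
  by auto

lemma prob: "p \<in> prob_vecs 3" "p' \<in> prob_vecs 3" "q \<in> prob_vecs 3"
  using \<epsilon> \<delta> by (auto simp: prob_vecs_def less_3 lessThan_3 intro: carrier_vecI)

lemma close: "(\<Sum>x<3. \<bar>p $ x - p' $ x\<bar>) \<le> 2 * \<epsilon>"
  using \<epsilon> by (simp add: lessThan_3)

lemma vec_supp [simp]: "vec_supp p = {0, 2}" "vec_supp p' = {0, Suc 0}" "vec_supp q = {0, Suc 0}"
  using \<epsilon> \<delta> by (auto simp: vec_supp_def less_3)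

lemma renyi_p_ge_one: "1 \<le> \<alpha> \<Longrightarrow> renyi_div \<alpha> p q = \<infinity>"
  by (auto simp: renyi_div_def)

text \<open>Only index 0 contributes: at index 2 the factor \<open>0 powr (1 - a)\<close>
  vanishes.\<close>

lemma renyi_p_less_one:
  assumes "0 \<le> a" "a < 1"
  shows "renyi_div (ereal a) p q = ereal (- log 2 \<delta> - a / (1 - a) * log 2 (1 - \<epsilon>))"
proof -
  have "renyi_div (ereal a) p q = ereal (1 / (a - 1) * log 2 ((1 - \<epsilon>) powr a * \<delta> powr (1 - a)))"
    using assms prob by (subst renyi_div_less_one[of a q 3]) auto
  also have "log 2 ((1 - \<epsilon>) powr a * \<delta> powr (1 - a)) = a * log 2 (1 - \<epsilon>) + (1 - a) * log 2 \<delta>"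
    using \<epsilon> \<delta> by (simp add: log_mult_pos log_powr)
  also have "1 / (a - 1) * \<dots> = - log 2 \<delta> - a / (1 - a) * log 2 (1 - \<epsilon>)"
    using assms by (simp add: field_simps)
  finally show ?thesis .
qed

text \<open>\<open>p'\<close> and \<open>q\<close> have the same support, so no infinite clause of
  \<open>renyi_div\<close> applies.\<close>

lemma renyi_p'_finite:
  obtains y where "renyi_div \<beta> p' q = ereal y"
proof -
  have "renyi_div \<beta> p' q \<noteq> \<infinity>" by (simp add: renyi_div_def Let_def)
  then show thesis
    using that renyi_div_not_MInfty[of \<beta> p' q] by (cases "renyi_div \<beta> p' q") auto
qed

lemma renyi_p'_less_one:
  assumes "0 \<le> b" "b < 1"
  shows "renyi_div (ereal b) p' q = ereal (1 / (b - 1) *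
    log 2 ((1 - \<epsilon>) powr b * \<delta> powr (1 - b) + \<epsilon> powr b * (1 - \<delta>) powr (1 - b)))"
  using assms prob by (subst renyi_div_less_one[of b q 3]) auto

lemma renyi_p'_one:
  "renyi_div 1 p' q = ereal ((1 - \<epsilon>) * log 2 ((1 - \<epsilon>) / \<delta>) + \<epsilon> * log 2 (\<epsilon> / (1 - \<delta>)))"
  by (simp add: renyi_div_def)

lemma renyi_p'_greater_one:
  assumes "1 < b"
  shows "renyi_div (ereal b) p' q = ereal (1 / (b - 1) *
    log 2 ((1 - \<epsilon>) powr b * \<delta> powr (1 - b) + \<epsilon> powr b * (1 - \<delta>) powr (1 - b)))"
  using assms by (subst renyi_div_greater_one) auto

lemma renyi_p'_infinity:
  "renyi_div \<infinity> p' q = ereal (log 2 (max ((1 - \<epsilon>) / \<delta>) (\<epsilon> / (1 - \<delta>))))"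
  by (subst renyi_div_infinity) auto

lemma nu_ge:
  assumes "quantum_extension (renyi_div \<beta>) D" "renyi_div \<beta> p' q = ereal y"
  shows "renyi_div \<alpha> p q - ereal y \<le> nu \<epsilon> \<alpha> D"
  using assms nu_ge_classical prob close by blast

end

section \<open>Values of \<open>nu\<close> obtained from the extremal triple\<close>

lemma nu_ge_one:
  assumes "0 < \<epsilon>" "\<epsilon> < 1" "1 \<le> \<alpha>" "quantum_extension (renyi_div \<beta>) D"
  shows "nu \<epsilon> \<alpha> D = \<infinity>"
proof -
  \<comment> \<open>Any \<delta> strictly between 0 and 1 serves: \<open>p\<close> has mass outside
    the support of \<open>q\<close>, while \<open>p'\<close> has none.\<close>
  interpret extremal_triple \<epsilon> "1 / 2" using assms by unfold_locales auto
  obtain y where "renyi_div \<beta> p' q = ereal y" by (rule renyi_p'_finite)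
  from nu_ge[OF assms(4) this, of \<alpha>] show ?thesis using renyi_p_ge_one[OF assms(3)] by simp
qed

lemma ereal_le_trans: "A \<le> B \<Longrightarrow> ereal B \<le> x \<Longrightarrow> ereal A \<le> x"
  by (metis ereal_less_eq(3) order.trans)

lemma ereal_infinity_of_log_bound:
  assumes "0 < s" and bound: "\<And>\<delta>. 0 < \<delta> \<Longrightarrow> \<delta> \<le> 1 / 2 \<Longrightarrow> ereal (s * - log 2 \<delta> + c) \<le> x"
  shows "x = \<infinity>"
proof (rule ereal_top)
  fix B
  \<comment> \<open>The witness is \<delta> = 2^(-K): the quotient pushes the bound above
    \<open>B\<close>, and the maximum with 1 keeps \<delta> at most 1/2.\<close>
  define K where "K = max 1 ((B - c) / s)"
  have "B \<le> s * K + c" using assms(1) by (simp add: K_def max_def field_simps split: if_splits)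
  moreover have "2 powr - K \<le> 2 powr - 1" by (subst powr_le_cancel_iff) (auto simp: K_def)
  then have "2 powr - K \<le> 1 / 2" by (simp add: powr_minus_divide)
  then have "ereal (s * - log 2 (2 powr - K) + c) \<le> x" by (intro bound) simp_all
  then have "ereal (s * K + c) \<le> x" by (simp add: log_powr)
  ultimately show "ereal B \<le> x" by (rule ereal_le_trans)
qed

text \<open>As \<delta> tends to 0, the divergence of \<open>p\<close> grows like -log \<delta>.
  That of \<open>p'\<close> grows only like (1 - \<epsilon>) (-log \<delta>) at order 1 and stays
  bounded above below order 1, so the gap is unbounded.\<close>

lemma nu_beta_le_one:
  assumes \<epsilon>: "0 < \<epsilon>" "\<epsilon> < 1" and "0 \<le> \<alpha>" "\<alpha> < 1" "0 \<le> \<beta>" "\<beta> \<le> 1"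
    and D: "quantum_extension (renyi_div \<beta>) D"
  shows "nu \<epsilon> \<alpha> D = \<infinity>"
proof -
  obtain a where a: "\<alpha> = ereal a" "0 \<le> a" "a < 1" using assms by (cases \<alpha>) auto
  obtain b where b: "\<beta> = ereal b" "0 \<le> b" "b \<le> 1" using assms by (cases \<beta>) auto
  define c where "c = - a / (1 - a) * log 2 (1 - \<epsilon>)"
  show ?thesis
  proof (cases "b = 1")
    case True
    show ?thesis
    proof (rule ereal_infinity_of_log_bound[OF \<epsilon>(1)])
      fix \<delta> :: real assume \<delta>_bounds: "0 < \<delta>" "\<delta> \<le> 1 / 2"
      interpret extremal_triple \<epsilon> \<delta> using \<epsilon> \<delta>_bounds by unfold_locales auto
      let ?y = "(1 - \<epsilon>) * log 2 ((1 - \<epsilon>) / \<delta>) + \<epsilon> * log 2 (\<epsilon> / (1 - \<delta>))"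
      have "renyi_div \<beta> p' q = ereal ?y" using renyi_p'_one by (simp add: b True one_ereal_def)
      from nu_ge[OF D this, of \<alpha>]
      have "ereal (- log 2 \<delta> + c - ?y) \<le> nu \<epsilon> \<alpha> D"
        using a by (simp add: renyi_p_less_one c_def)
      moreover have "\<epsilon> * - log 2 \<delta> + (c - \<epsilon>  - (1 - \<epsilon>) * log 2 (1 - \<epsilon>) - \<epsilon> * log 2 \<epsilon>) \<le> - log 2 \<delta> + c - ?y"
      proof -
        \<comment> \<open>For \<delta> \<le> 1/2 the logarithm of 1 - \<delta> is at least -1,
          whence the term -\<epsilon> in the constant.\<close>
        have "log 2 (1 / 2) \<le> log 2 (1 - \<delta>)" using \<delta>_bounds by (intro log_mono) auto
        then have "\<epsilon> * - 1 \<le> \<epsilon> * log 2 (1 - \<delta>)" using \<epsilon> by (intro mult_left_mono) (auto simp: log_divide)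
        then show ?thesis using \<epsilon> \<delta>_bounds by (simp add: log_divide algebra_simps)
      qed
      ultimately show "ereal (\<epsilon> * - log 2 \<delta> + (c - \<epsilon> - (1 - \<epsilon>) * log 2 (1 - \<epsilon>) - \<epsilon> * log 2 \<epsilon>)) \<le> nu \<epsilon> \<alpha> D"
        by (rule ereal_le_trans[rotated])
    qed
  next
    case False
    then have b1: "b < 1" using b by simp
    let ?k = "log 2 (\<epsilon> powr b * (1 / 2) powr (1 - b))"
    show ?thesis
    proof (rule ereal_infinity_of_log_bound[of 1])
      fix \<delta> :: real assume \<delta>_bounds: "0 < \<delta>" "\<delta> \<le> 1 / 2"
      interpret extremal_triple \<epsilon> \<delta> using \<epsilon> \<delta>_bounds by unfold_locales auto
      let ?L = "log 2 ((1 - \<epsilon>) powr b * \<delta> powr (1 - b) + \<epsilon> powr b * (1 - \<delta>) powr (1 - b))"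
      \<comment> \<open>The term at index 1 alone bounds the sum below independently of \<delta>;
        the negative prefactor 1 / (b - 1) makes this an upper bound on the divergence.\<close>
      have "\<epsilon> powr b * (1 / 2) powr (1 - b) \<le> \<epsilon> powr b * (1 - \<delta>) powr (1 - b)"
        using \<delta>_bounds b1 by (intro mult_left_mono powr_mono2) auto
      also have "\<dots> \<le> (1 - \<epsilon>) powr b * \<delta> powr (1 - b) + \<epsilon> powr b * (1 - \<delta>) powr (1 - b)" by simp
      finally have "?k \<le> ?L" using \<epsilon> by (intro log_mono) auto
      then have "1 / (1 - b) * ?k \<le> 1 / (1 - b) * ?L" using b1 by (intro mult_left_mono) auto
      moreover have "1 / (b - 1) * X = - (1 / (1 - b) * X)" for X using b1 by (simp add: field_simps)
      ultimately have "1 * - log 2 \<delta> + (c + 1 / (1 - b) * ?k) \<le> - log 2 \<delta> + c - 1 / (b - 1) * ?L"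
        by simp
      moreover have "ereal (- log 2 \<delta> + c - 1 / (b - 1) * ?L) \<le> nu \<epsilon> \<alpha> D"
        using nu_ge[OF D[unfolded b(1)] renyi_p'_less_one[OF b(2) b1], of \<alpha>] a
        by (simp add: renyi_p_less_one c_def)
      ultimately show "ereal (1 * - log 2 \<delta> + (c + 1 / (1 - b) * ?k)) \<le> nu \<epsilon> \<alpha> D"
        by (rule ereal_le_trans)
    qed simp
  qed
qed

lemma nu_ge_optimal_constant:
  assumes \<epsilon>: "0 < \<epsilon>" "\<epsilon> < 1" and "0 \<le> \<alpha>" "\<alpha> < 1" "1 < \<beta>"
    and D: "quantum_extension (renyi_div \<beta>) D"
  shows "optimal_constant \<epsilon> \<alpha> \<beta> \<le> nu \<epsilon> \<alpha> D"
proof -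
  obtain a where a: "\<alpha> = ereal a" "0 \<le> a" "a < 1" using assms by (cases \<alpha>) auto
  have L: "log 2 (1 / (1 - \<epsilon>)) = - log 2 (1 - \<epsilon>)" using \<epsilon> by (simp add: log_divide)
  have a_frac: "1 / (1 - a) = 1 + a / (1 - a)" using a by (simp add: field_simps)
  show ?thesis
  proof (cases "\<beta> = \<infinity>")
    case True
    \<comment> \<open>With \<delta> \<le> 1 - \<epsilon> the maximal ratio is attained at index 0.
      Then log \<delta> cancels in the difference and the constant is reached exactly, without a
      limit.\<close>
    define \<delta> where "\<delta> = min (1 / 2) (1 - \<epsilon>)"
    interpret extremal_triple \<epsilon> \<delta> using \<epsilon> by unfold_locales (auto simp: \<delta>_def)
    have "\<delta> \<le> 1 - \<epsilon>" by (simp add: \<delta>_def)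
    then have "\<epsilon> / (1 - \<delta>) \<le> 1" "1 \<le> (1 - \<epsilon>) / \<delta>"
      using \<delta> by (simp_all add: divide_le_eq le_divide_eq)
    then have "max ((1 - \<epsilon>) / \<delta>) (\<epsilon> / (1 - \<delta>)) = (1 - \<epsilon>) / \<delta>"
      by (intro max_absorb1) (rule order.trans)
    then have "renyi_div \<beta> p' q = ereal (log 2 ((1 - \<epsilon>) / \<delta>))"
      unfolding True renyi_p'_infinity by simp
    from nu_ge[OF D this, of \<alpha>]
    have "ereal (- log 2 \<delta> - a / (1 - a) * log 2 (1 - \<epsilon>) - log 2 ((1 - \<epsilon>) / \<delta>)) \<le> nu \<epsilon> \<alpha> D"
      using a by (simp add: renyi_p_less_one)
    moreover have "- log 2 \<delta> - a / (1 - a) * log 2 (1 - \<epsilon>) - log 2 ((1 - \<epsilon>) / \<delta>) =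
        1 / (1 - a) * log 2 (1 / (1 - \<epsilon>))"
      unfolding L a_frac using \<epsilon> \<delta> by (simp add: log_divide algebra_simps)
    ultimately show ?thesis unfolding a(1) True optimal_constant_infinity[OF a(3)] by simp
  next
    case False
    then obtain b where b: "\<beta> = ereal b" "1 < b" using assms by (cases \<beta>) auto
    define r where "r = (1 / (b - 1) + 1 / (1 - a)) * log 2 (1 / (1 - \<epsilon>))"
    \<comment> \<open>For finite \<beta> the term of \<open>p'\<close> at index 1 never vanishes, so
      this triple reaches the constant only up to an arbitrary error \<open>e\<close>.\<close>
    have "ereal r \<le> nu \<epsilon> \<alpha> D + ereal e" if e: "0 < e" for e
    proof -
      \<comment> \<open>\<open>R\<close> is the intended ratio of the term at index 1 to that at
        index 0: the factor 1 + R = 2^(e (b - 1)) adds exactly \<open>e\<close> to the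
        divergence.\<close>
      define R where "R = 2 powr (e * (b - 1)) - 1"
      have R: "0 < R" using e b by (simp add: R_def)
      \<comment> \<open>\<open>t\<close> stands for \<delta> / (1 - \<delta>); the prescribed ratio
        \<open>R\<close> amounts to t^(b - 1) = R ((1 - \<epsilon>) / \<epsilon>)^b.\<close>
      define t where "t = (R * ((1 - \<epsilon>) / \<epsilon>) powr b) powr (1 / (b - 1))"
      have t: "0 < t" "t powr (b - 1) = R * ((1 - \<epsilon>) / \<epsilon>) powr b"
        using R \<epsilon> b by (auto simp: t_def powr_powr)
      define \<delta> where "\<delta> = t / (1 + t)"
      have "1 - \<delta> = 1 / (1 + t)" using t(1) by (simp add: \<delta>_def field_simps)
      then have \<delta>01: "0 < \<delta>" "\<delta> < 1" "1 - \<delta> = \<delta> / t" using t(1) by (simp_all add: \<delta>_def)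
      interpret extremal_triple \<epsilon> \<delta> using \<epsilon> \<delta>01 by unfold_locales auto
      have "\<epsilon> powr b * (1 - \<delta>) powr (1 - b) = \<epsilon> powr b * (\<delta> powr (1 - b) * t powr (b - 1))"
        unfolding \<delta>01(3) using t(1) \<delta>01 by (simp add: powr_divide powr_diff field_simps)
      also have "\<dots> = (1 - \<epsilon>) powr b * \<delta> powr (1 - b) * R"
        unfolding t(2) using \<epsilon> by (simp add: powr_divide)
      finally have "(1 - \<epsilon>) powr b * \<delta> powr (1 - b) + \<epsilon> powr b * (1 - \<delta>) powr (1 - b) =
          (1 - \<epsilon>) powr b * \<delta> powr (1 - b) * 2 powr (e * (b - 1))"
        by (simp add: R_def algebra_simps)
      also have "log 2 \<dots> = b * log 2 (1 - \<epsilon>) + (1 - b) * log 2 \<delta> + e * (b - 1)"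
        using \<epsilon> \<delta>01 by (simp add: log_mult_pos log_powr)
      also have "1 / (b - 1) * \<dots> = b / (b - 1) * log 2 (1 - \<epsilon>) - log 2 \<delta> + e"
        using b by (simp add: field_simps)
      finally have "renyi_div \<beta> p' q = ereal (b / (b - 1) * log 2 (1 - \<epsilon>) - log 2 \<delta> + e)"
        unfolding b(1) renyi_p'_greater_one[OF b(2)] by simp
      from nu_ge[OF D this, of \<alpha>]
      have bound: "ereal (- log 2 \<delta> - a / (1 - a) * log 2 (1 - \<epsilon>) -
          (b / (b - 1) * log 2 (1 - \<epsilon>) - log 2 \<delta> + e)) \<le> nu \<epsilon> \<alpha> D"
        using a by (simp add: renyi_p_less_one)
      have "b / (b - 1) = 1 + 1 / (b - 1)" using b by (simp add: field_simps)
      then have "- log 2 \<delta> - a / (1 - a) * log 2 (1 - \<epsilon>) -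
          (b / (b - 1) * log 2 (1 - \<epsilon>) - log 2 \<delta> + e) = r - e"
        unfolding r_def L a_frac by (simp add: algebra_simps)
      then have "ereal (r - e) \<le> nu \<epsilon> \<alpha> D" using bound by (simp only:)
      then have "ereal (r - e) + ereal e \<le> nu \<epsilon> \<alpha> D + ereal e" by (rule add_right_mono)
      then show ?thesis by simp
    qed
    then have "ereal r \<le> nu \<epsilon> \<alpha> D" by (rule ereal_le_epsilon2)
    then show ?thesis unfolding a(1) b(1) optimal_constant_finite[OF a(3) b(2)] r_def .
  qed
qed

theorem theorem2:
  fixes \<epsilon> :: real and \<alpha> \<beta> :: ereal
    and D :: "complex mat \<Rightarrow> complex mat \<Rightarrow> ereal"
  assumes "0 < \<epsilon>" and "\<epsilon> < 1" and "0 \<le> \<alpha>" and "0 \<le> \<beta>"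
    and "quantum_extension (renyi_div \<beta>) D"
  shows "nu \<epsilon> \<alpha> D =
           (if \<alpha> < 1 \<and> 1 < \<beta>
            then (1 / (\<beta> - 1) + 1 / (1 - \<alpha>)) * ereal (log 2 (1 / (1 - \<epsilon>)))
            else \<infinity>)"
proof (cases "\<alpha> < 1 \<and> 1 < \<beta>")
  case True
  then have "nu \<epsilon> \<alpha> D = optimal_constant \<epsilon> \<alpha> \<beta>"
    using nu_le_optimal_constant nu_ge_optimal_constant assms by (intro order.antisym) auto
  then show ?thesis using True by (simp add: optimal_constant_def)
next
  case False
  then have "1 \<le> \<alpha> \<or> \<alpha> < 1 \<and> \<beta> \<le> 1" by auto
  then have "nu \<epsilon> \<alpha> D = \<infinity>" using nu_ge_one nu_beta_le_one assms by blast
  then show ?thesis using False by auto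
qed

end
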